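(* Let $T\in{\rm Aut}(X,\mathcal B,\mu)$ be ergodic. The following are equivalent: (i) $T$ is weakly mixing; (ii) the topological lens $\widetilde T$ on $C_2(\mu)$ is topologically transitive; (iii) $\widetilde T$ is topologically weakly mixing.
   Context: $(X,\mathcal B,\mu)$ standard probability space. $C_2(\mu)$: probability measures on $X\times X$ with both marginals $\mu$, with the compact metrizable topology $\rho_n\to\rho$ iff $\rho_n(A\times B)\to\rho(A\times B)$ for all measurable $A,B$. Topological lens: $\widetilde T(\rho)(A\times B)=\rho(T^{-1}A\times T^{-1}B)$. A homeomorphism $R$ of a compact space $Z$ is topologically transitive if for all nonempty open $U,V$ there is $n$ with $R^{-n}U\cap V\ne\emptyset$; topologically weakly mixing if $R\times R$ is topologically transitive on $Z\times Z$. *)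

theory Defs
  imports "HOL-Probability.Probability"
begin

definition standard_prob_space :: "'a::polish_space measure \<Rightarrow> bool" where
  "standard_prob_space M \<longleftrightarrow> prob_space M \<and> sets M = sets borel"

definition Aut :: "'a measure \<Rightarrow> ('a \<Rightarrow> 'a) set" where
  "Aut M = {T. bij_betw T (space M) (space M) \<and> T \<in> M \<rightarrow>\<^sub>M M
              \<and> the_inv_into (space M) T \<in> M \<rightarrow>\<^sub>M M
              \<and> (\<forall>A\<in>sets M. measure M (T -` A \<inter> space M) = measure M A)}"

definition ergodic :: "'a measure \<Rightarrow> ('a \<Rightarrow> 'a) \<Rightarrow> bool" where
  "ergodic M T \<longleftrightarrow> (\<forall>A\<in>sets M. T -` A \<inter> space M = A \<longrightarrow> measure M A = 0 \<or> measure M A = 1)"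

definition weakly_mixing :: "'a measure \<Rightarrow> ('a \<Rightarrow> 'a) \<Rightarrow> bool" where
  "weakly_mixing M T \<longleftrightarrow> (\<forall>A\<in>sets M. \<forall>B\<in>sets M.
     (\<lambda>n. (\<Sum>k<n. \<bar>measure M ((T ^^ k) -` A \<inter> B) - measure M A * measure M B\<bar>) / real n)
       \<longlonglongrightarrow> 0)"

definition C2 :: "'a measure \<Rightarrow> ('a \<times> 'a) measure set" where
  "C2 M = {\<rho>. sets \<rho> = sets (M \<Otimes>\<^sub>M M) \<and> prob_space \<rho>
             \<and> distr \<rho> M fst = M \<and> distr \<rho> M snd = M}"

text \<open>The topology on C_2(mu): the coarsest topology making every map
  rho |-> rho(A x B) (A, B measurable) continuous, i.e. rho_n -> rho iff
  rho_n(A x B) -> rho(A x B) for all measurable A, B.\<close>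
definition C2_topology :: "'a measure \<Rightarrow> ('a \<times> 'a) measure topology" where
  "C2_topology M = topology_generated_by
     {{\<rho>\<in>C2 M. measure \<rho> (A \<times> B) \<in> U} | A B U. A \<in> sets M \<and> B \<in> sets M \<and> open U}"

definition lens :: "'a measure \<Rightarrow> ('a \<Rightarrow> 'a) \<Rightarrow> ('a \<times> 'a) measure \<Rightarrow> ('a \<times> 'a) measure" where
  "lens M T \<rho> = distr \<rho> (M \<Otimes>\<^sub>M M) (\<lambda>(x, y). (T x, T y))"

definition top_transitive :: "'z topology \<Rightarrow> ('z \<Rightarrow> 'z) \<Rightarrow> bool" where
  "top_transitive Z R \<longleftrightarrow> (\<forall>U V. openin Z U \<and> U \<noteq> {} \<and> openin Z V \<and> V \<noteq> {}
      \<longrightarrow> (\<exists>n::nat. (R ^^ n) -` U \<inter> V \<noteq> {}))"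

definition top_weakly_mixing :: "'z topology \<Rightarrow> ('z \<Rightarrow> 'z) \<Rightarrow> bool" where
  "top_weakly_mixing Z R \<longleftrightarrow> top_transitive (prod_topology Z Z) (\<lambda>(x, y). (R x, R y))"

end

theory Submission
  imports Defs
begin

text \<open>
  If the lens is transitive, then every continuous invariant function on the self-couplings is
  constant. For a \<open>T \<times> T\<close>-invariant set \<open>F\<close> with fibres \<open>F\<^sub>z\<close>, the function
  \<open>\<rho> \<mapsto> \<integral> \<rho> (F\<^sub>z \<times> F\<^sub>z) d\<mu> z\<close> is continuous and invariant. Its values at the diagonal coupling
  and at the product coupling are \<open>\<integral> \<mu> F\<^sub>z\<close> and \<open>\<integral> (\<mu> F\<^sub>z)\<^sup>2\<close>, so \<open>\<mu> F\<^sub>z\<close> is almost surely 0 or 1, and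
  by ergodicity of \<open>T\<close> it is almost surely constant. Hence \<open>T \<times> T\<close> is ergodic, and the ergodic theorem
  for \<open>T\<close> and \<open>T \<times> T\<close> shows that \<open>\<mu> (T\<^sup>-\<^sup>k A \<inter> B) - \<mu> A * \<mu> B\<close> tends to 0 in quadratic mean.

  Conversely, weak mixing gives times \<open>n\<close> at which a given finite partition and its preimage under
  \<open>T\<^sup>n\<close> are almost independent. At such a time one can prescribe, up to a small error, both a
  self-coupling and its image under the \<open>n\<close>-th iterate of the lens on the blocks of the partition.
  The time depends only on the partition, so two pairs of couplings can be treated simultaneously.
\<close>

section \<open>The ergodic theorem for bounded functions\<close>

locale measure_preserving_system = prob_space M for M :: "'a measure" +
  fixes T :: "'a \<Rightarrow> 'a"
  assumes T_measurable [measurable]: "T \<in> M \<rightarrow>\<^sub>M M"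
    and distr_T: "distr M M T = M"
begin

lemma funpow_measurable [measurable]: "(T ^^ n) \<in> M \<rightarrow>\<^sub>M M"
  by (induction n) (simp_all add: measurable_compose measurable_comp)

lemma distr_funpow: "distr M M (T ^^ n) = M"
proof (induction n)
  case (Suc n)
  have "distr M M (T ^^ Suc n) = distr (distr M M (T ^^ n)) M T"
    by (subst distr_distr) simp_all
  with Suc show ?case by (simp only: distr_T)
qed (simp add: distr_id2)

lemma measure_vimage_funpow:
  assumes "A \<in> sets M"
  shows "measure M ((T ^^ n) -` A \<inter> space M) = measure M A"
  using assms by (metis distr_funpow funpow_measurable measure_distr)

lemma vimage_funpow_Int_measurable:
  assumes A: "A \<in> sets M" and B: "B \<in> sets M"
  shows "(T ^^ n) -` A \<inter> B \<in> sets M"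
proof -
  have "(T ^^ n) -` A \<inter> B = ((T ^^ n) -` A \<inter> space M) \<inter> B"
    using sets.sets_into_space[OF B] by auto
  then show ?thesis by (metis A B funpow_measurable measurable_sets sets.Int)
qed

section \<open>Birkhoff sums and the maximal ergodic inequality\<close>

lemma integral_comp_T:
  fixes f :: "'a \<Rightarrow> real"
  assumes "f \<in> borel_measurable M"
  shows "(\<integral>x. f (T x) \<partial>M) = integral\<^sup>L M f"
  by (metis T_measurable assms distr_T integral_distr)

lemma sum_funpow_T: "(\<Sum>k<n. f ((T ^^ k) (T x))) = (\<Sum>k<n. f ((T ^^ k) x)) + f ((T ^^ n) x) - (f x :: real)"
  by (induction n) (simp_all add: funpow_swap1)

text \<open>This is the maximum of the Birkhoff sums of \<open>f\<close> over the times 0 to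
  \<open>n\<close>, the empty sum included. Recursion on the first step yields directly the
  comparison between \<open>x\<close> and \<open>T x\<close> on which Garsia's argument
  rests.\<close>

primrec maximal_sum :: "('a \<Rightarrow> real) \<Rightarrow> nat \<Rightarrow> 'a \<Rightarrow> real" where
  "maximal_sum f 0 x = 0"
| "maximal_sum f (Suc n) x = max 0 (f x + maximal_sum f n (T x))"

lemma maximal_sum_nonneg: "0 \<le> maximal_sum f n x"
  by (cases n) simp_all

lemma maximal_sum_measurable [measurable]:
  assumes [measurable]: "f \<in> borel_measurable M"
  shows "maximal_sum f n \<in> borel_measurable M"
proof (induction n)
  case 0
  have "maximal_sum f 0 = (\<lambda>x. 0)" by auto
  then show ?case by simp
next
  case (Suc n)
  note [measurable] = Suc
  have "maximal_sum f (Suc n) = (\<lambda>x. max 0 (f x + maximal_sum f n (T x)))" by auto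
  then show ?case by simp
qed

lemma maximal_sum_le_Suc: "maximal_sum f n x \<le> maximal_sum f (Suc n) x"
proof (induction n arbitrary: x)
  case (Suc n)
  show ?case using Suc[of "T x"] by (auto simp: max_def)
qed simp

lemma maximal_sum_mono: "n \<le> m \<Longrightarrow> maximal_sum f n x \<le> maximal_sum f m x"
  by (rule lift_Suc_mono_le[where f="\<lambda>n. maximal_sum f n x"]) (rule maximal_sum_le_Suc)

lemma sum_le_maximal_sum: "(\<Sum>k<n. f ((T ^^ k) x)) \<le> maximal_sum f n x"
proof (induction n arbitrary: x)
  case (Suc n)
  have "(\<Sum>k<Suc n. f ((T ^^ k) x)) = f x + (\<Sum>k<n. f ((T ^^ k) (T x)))"
    by (subst sum.lessThan_Suc_shift) (simp add: funpow_swap1)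
  then show ?case using Suc[of "T x"] by simp
qed simp

lemma maximal_sum_le:
  assumes "\<And>x. \<bar>f x\<bar> \<le> K"
  shows "maximal_sum f n x \<le> real n * K"
proof (induction n arbitrary: x)
  case (Suc n)
  show ?case using Suc[of "T x"] assms[of x] by (auto simp: algebra_simps)
qed simp

text \<open>Garsia's argument: \<^term>\<open>f\<close> dominates the coboundary of \<^term>\<open>maximal_sum f n\<close> on the
  set where the latter is positive.\<close>

lemma maximal_ergodic:
  assumes [measurable]: "f \<in> borel_measurable M" and bd: "\<And>x. \<bar>f x\<bar> \<le> K"
  shows "0 \<le> (\<integral>x. f x * indicator {x\<in>space M. 0 < maximal_sum f n x} x \<partial>M)"
proof -
  let ?m = "maximal_sum f n"
  have int_m: "integrable M ?m"
    using maximal_sum_le[OF bd] maximal_sum_nonneg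
    by (intro integrable_const_bound[where B="real n * K"]) (auto simp: abs_of_nonneg)
  have int_mT: "integrable M (\<lambda>x. ?m (T x))"
    using maximal_sum_le[OF bd] maximal_sum_nonneg
    by (intro integrable_const_bound[where B="real n * K"]) (auto simp: abs_of_nonneg)
  have "0 = (\<integral>x. ?m x - ?m (T x) \<partial>M)"
    using int_m int_mT by (simp add: integral_comp_T)
  also have "\<dots> \<le> (\<integral>x. f x * indicator {x\<in>space M. 0 < ?m x} x \<partial>M)"
  proof (intro integral_mono)
    show "integrable M (\<lambda>x. f x * indicator {x\<in>space M. 0 < ?m x} x)"
      using bd by (intro integrable_const_bound[where B="K"]) (auto simp: indicator_def intro: order_trans[OF _ bd])
    show "?m x - ?m (T x) \<le> f x * indicator {x\<in>space M. 0 < ?m x} x" if "x \<in> space M" for x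
    \<comment> \<open>Where the maximum is positive it is not attained by the empty sum, so the
      recursion bounds it by \<open>f x\<close> plus the maximum at \<open>T x\<close>. Elsewhere it
      vanishes and the left side is nonpositive.\<close>
    proof (cases "0 < ?m x")
      case True
      then obtain k where n: "n = Suc k" by (cases n) auto
      have "?m x = f x + maximal_sum f k (T x)" using True by (auto simp: n max_def split: if_splits)
      moreover have "maximal_sum f k (T x) \<le> ?m (T x)" by (rule maximal_sum_mono) (simp add: n)
      ultimately show ?thesis using True that by simp
    next
      case False
      then show ?thesis using maximal_sum_nonneg[of f n x] maximal_sum_nonneg[of f n "T x"] by simp
    qed
  qed (use int_m int_mT in auto)
  finally show ?thesis .
qed

text \<open>The sets where \<open>maximal_sum f n\<close> is positive increase with
  \<open>n\<close>, and by hypothesis almost every point belongs to one of them. The maximal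
  inequality therefore passes to the limit by dominated convergence.\<close>

lemma integral_nonneg_if_sums_positive:
  assumes [measurable]: "f \<in> borel_measurable M" and bd: "\<And>x. \<bar>f x\<bar> \<le> (K::real)"
    and pos: "AE x in M. \<exists>n. 0 < (\<Sum>k<n. f ((T ^^ k) x))"
  shows "0 \<le> integral\<^sup>L M f"
proof -
  have "(\<lambda>n. \<integral>x. f x * indicator {x\<in>space M. 0 < maximal_sum f n x} x \<partial>M) \<longlonglongrightarrow> integral\<^sup>L M f"
  proof (rule integral_dominated_convergence[where w="\<lambda>_. K"])
    show "AE x in M. (\<lambda>n. f x * indicator {x\<in>space M. 0 < maximal_sum f n x} x) \<longlonglongrightarrow> f x"
      using pos AE_space
    proof eventually_elim
      case (elim x)
      then obtain m where m: "0 < (\<Sum>k<m. f ((T ^^ k) x))" by auto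
      have "0 < maximal_sum f n x" if "n \<ge> m" for n
        using m sum_le_maximal_sum[of f x m] maximal_sum_mono[OF that, of f x] by linarith
      then have "eventually (\<lambda>n. f x * indicator {x\<in>space M. 0 < maximal_sum f n x} x = f x) sequentially"
        using elim by (intro eventually_sequentiallyI[of m]) auto
      then show ?case by (rule tendsto_eventually)
    qed
    show "AE x in M. norm (f x * indicator {x\<in>space M. 0 < maximal_sum f n x} x) \<le> K" for n
      using bd by (auto simp: indicator_def intro: order_trans[OF _ bd])
  qed simp_all
  then show ?thesis
    by (rule LIMSEQ_le_const) (use maximal_ergodic[OF assms(1) bd] in auto)
qed

section \<open>Pointwise convergence of Birkhoff averages\<close>

lemma limsup_averages_invariant:
  assumes bd: "\<And>x. \<bar>f x\<bar> \<le> (K::real)"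
  shows "limsup (\<lambda>n. ereal ((\<Sum>k<n. f ((T ^^ k) (T x))) / real n))
    = limsup (\<lambda>n. ereal ((\<Sum>k<n. f ((T ^^ k) x)) / real n))"
proof -
  \<comment> \<open>The averages at \<open>T x\<close> and at \<open>x\<close> differ by exactly
    this quotient, so once it tends to 0 they have the same limsup.\<close>
  have "(\<lambda>n. (f ((T ^^ n) x) - f x) / real n) \<longlonglongrightarrow> 0"
  proof (rule Lim_null_comparison[where g="\<lambda>n. 2 * K / real n"])
    show "\<forall>\<^sub>F n in sequentially. norm ((f ((T ^^ n) x) - f x) / real n) \<le> 2 * K / real n"
    proof (rule always_eventually, rule allI)
      fix n show "norm ((f ((T ^^ n) x) - f x) / real n) \<le> 2 * K / real n"
        using bd[of x] bd[of "(T ^^ n) x"] by (auto simp: divide_simps)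
    qed
  qed (rule lim_const_over_n)
  then have "(\<lambda>n. ereal ((f ((T ^^ n) x) - f x) / real n)) \<longlonglongrightarrow> ereal 0" by simp
  from ereal_limsup_lim_add[OF this, of "\<lambda>n. ereal ((\<Sum>k<n. f ((T ^^ k) x)) / real n)"]
  show ?thesis by (simp add: sum_funpow_T add_divide_distrib diff_divide_distrib algebra_simps)
qed

text \<open>For \<open>c\<close> above the integral, the set where the limsup exceeds
  \<open>c\<close> is invariant, hence null or of full measure. Full measure would give
  \<open>f - c\<close> a positive Birkhoff sum at almost every point and force the integral of
  \<open>f\<close> to be at least \<open>c\<close>. Finally \<open>c\<close> decreases to the
  integral along a sequence.\<close>

lemma ergodic_limsup_averages_le:
  assumes erg: "ergodic M T"
    and [measurable]: "f \<in> borel_measurable M" and bd: "\<And>x. \<bar>f x\<bar> \<le> (K::real)"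
  shows "AE x in M. limsup (\<lambda>n. ereal ((\<Sum>k<n. f ((T ^^ k) x)) / real n)) \<le> ereal (integral\<^sup>L M f)"
proof -
  define L where "L x = limsup (\<lambda>n. ereal ((\<Sum>k<n. f ((T ^^ k) x)) / real n))" for x
  have [measurable]: "L \<in> borel_measurable M" unfolding L_def by measurable
  have int: "integrable M f"
    using bd by (intro integrable_const_bound[where B="K"]) auto
  have upper: "AE x in M. L x \<le> ereal c" if c: "integral\<^sup>L M f < c" for c
  proof -
    let ?G = "{x\<in>space M. ereal c < L x}"
    have "T -` ?G \<inter> space M = ?G"
      using limsup_averages_invariant[of f K, OF bd] measurable_space[OF T_measurable] by (auto simp: L_def)
    moreover have "?G \<in> sets M" by measurable
    ultimately consider "prob ?G = 0" | "prob ?G = 1" using erg unfolding ergodic_def by blast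
    then show ?thesis
    proof cases
      case 1
      then have "AE x in M. \<not> ereal c < L x"
        by (subst AE_iff_measurable[where N="?G"]) (auto simp: emeasure_eq_measure)
      then show ?thesis by (auto simp: not_less)
    next
      case 2
      then have "AE x in M. ereal c < L x" by (subst prob_Collect_eq_1[symmetric]) auto
      then have "AE x in M. \<exists>n. 0 < (\<Sum>k<n. f ((T ^^ k) x) - c)"
      proof eventually_elim
        case (elim x)
        have "\<not> (\<forall>\<^sub>F n in sequentially. ereal ((\<Sum>k<n. f ((T ^^ k) x)) / real n) \<le> ereal c)"
        proof
          assume "\<forall>\<^sub>F n in sequentially. ereal ((\<Sum>k<n. f ((T ^^ k) x)) / real n) \<le> ereal c"
          then have "L x \<le> ereal c" unfolding L_def by (rule Limsup_bounded)
          with elim show False by simp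
        qed
        \<comment> \<open>The threshold 1 excludes \<open>n = 0\<close>, where the quotient is 0 by
          the convention on division and says nothing about the sum.\<close>
        then obtain n where n: "c < (\<Sum>k<n. f ((T ^^ k) x)) / real n" "n \<ge> 1"
          unfolding eventually_sequentially by (auto simp: not_le)
        then show ?case
          by (intro exI[of _ n]) (auto simp: sum_subtractf field_simps)
      qed
      moreover have "\<bar>f x - c\<bar> \<le> K + \<bar>c\<bar>" for x
        using bd[of x] by linarith
      ultimately have "0 \<le> (\<integral>x. f x - c \<partial>M)"
        by (intro integral_nonneg_if_sums_positive[where K="K + \<bar>c\<bar>"]) auto
      then show ?thesis using int c by (simp add: prob_space)
    qed
  qed
  have "AE x in M. \<forall>j. L x \<le> ereal (integral\<^sup>L M f + 1 / real (Suc j))"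
    by (subst AE_all_countable) (auto intro: upper)
  then show ?thesis
  proof eventually_elim
    case (elim x)
    have "(\<lambda>j. ereal (integral\<^sup>L M f + 1 / real (Suc j))) \<longlonglongrightarrow> ereal (integral\<^sup>L M f + 0)"
      by (intro tendsto_intros LIMSEQ_Suc lim_1_over_n)
    then have "L x \<le> ereal (integral\<^sup>L M f + 0)"
      by (rule LIMSEQ_le_const) (use elim in blast)
    then show ?case by (simp add: L_def)
  qed
qed

text \<open>The upper bound on the limsup, applied to \<open>f\<close> and to its negative, encloses
  liminf and limsup by the same constant.\<close>

theorem birkhoff_ergodic_bounded:
  assumes erg: "ergodic M T"
    and [measurable]: "f \<in> borel_measurable M" and bd: "\<And>x. \<bar>f x\<bar> \<le> (K::real)"
  shows "AE x in M. (\<lambda>n. (\<Sum>k<n. f ((T ^^ k) x)) / real n) \<longlonglongrightarrow> integral\<^sup>L M f"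
proof -
  have "AE x in M. limsup (\<lambda>n. ereal ((\<Sum>k<n. - f ((T ^^ k) x)) / real n)) \<le> ereal (\<integral>x. - f x \<partial>M)"
    by (rule ergodic_limsup_averages_le[OF erg, where K=K]) (use bd in auto)
  with ergodic_limsup_averages_le[OF erg assms(2) bd] show ?thesis
  proof eventually_elim
    case (elim x)
    let ?A = "\<lambda>n. ereal ((\<Sum>k<n. f ((T ^^ k) x)) / real n)"
    have "limsup (\<lambda>n. - ?A n) \<le> - ereal (integral\<^sup>L M f)"
      using elim(2) by (simp add: sum_negf)
    moreover have "limsup (\<lambda>n. - ?A n) = - liminf ?A" by (rule ereal_Limsup_uminus)
    ultimately have "ereal (integral\<^sup>L M f) \<le> liminf ?A"
      by (metis ereal_minus_le_minus)
    with elim(1) show ?case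
      by (intro limsup_le_liminf_real) auto
  qed
qed

text \<open>Pointwise convergence for the indicator of \<open>A\<close> is integrated against the
  indicator of \<open>B\<close>. The averages lie between 0 and 1, so dominated convergence
  applies.\<close>

corollary ergodic_average_measure:
  assumes erg: "ergodic M T" and [measurable]: "A \<in> sets M" "B \<in> sets M"
  shows "(\<lambda>n. (\<Sum>k<n. measure M ((T ^^ k) -` A \<inter> B)) / real n) \<longlonglongrightarrow> measure M A * measure M B"
proof -
  have "(\<lambda>n. \<integral>x. (\<Sum>k<n. indicator A ((T ^^ k) x)) / real n * indicator B x \<partial>M)
      \<longlonglongrightarrow> (\<integral>x. measure M A * indicator B x \<partial>M)"
  proof (rule integral_dominated_convergence[where w="\<lambda>_. 1"])
    show "AE x in M. (\<lambda>n. (\<Sum>k<n. indicator A ((T ^^ k) x)) / real n * indicator B x)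
        \<longlonglongrightarrow> measure M A * indicator B x"
      using birkhoff_ergodic_bounded[OF erg, of "indicator A" 1]
      by (auto simp: indicator_def intro!: tendsto_intros)
    have "(\<Sum>k<n. indicator A ((T ^^ k) x)) \<le> real n" for n x
      using sum_mono[of "{..<n}" "\<lambda>k. indicator A ((T ^^ k) x)" "\<lambda>_. 1::real"] by (simp add: indicator_def)
    then show "AE x in M. norm ((\<Sum>k<n. indicator A ((T ^^ k) x)) / real n * indicator B x) \<le> 1" for n
      by (auto simp: indicator_def divide_le_eq_1 sum_nonneg)
  qed simp_all
  moreover have "(\<integral>x. (\<Sum>k<n. indicator A ((T ^^ k) x)) / real n * indicator B x \<partial>M)
      = (\<Sum>k<n. measure M ((T ^^ k) -` A \<inter> B)) / real n" for n
  proof -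
    have sets: "(T ^^ k) -` A \<inter> B \<in> sets M" for k
      by (rule vimage_funpow_Int_measurable) fact+
    have "(\<integral>x. (\<Sum>k<n. indicator A ((T ^^ k) x)) / real n * indicator B x \<partial>M)
        = (\<integral>x. (\<Sum>k<n. indicator ((T ^^ k) -` A \<inter> B) x) / real n \<partial>M)"
      by (intro Bochner_Integration.integral_cong) (auto simp: sum_distrib_right indicator_def)
    also have "\<dots> = (\<Sum>k<n. measure M ((T ^^ k) -` A \<inter> B)) / real n"
      using sets by (simp add: Bochner_Integration.integral_sum emeasure_eq_measure)
    finally show ?thesis .
  qed
  moreover have "(\<integral>x. measure M A * indicator B x \<partial>M) = measure M A * measure M B" by simp
  ultimately show ?thesis by (simp only:)
qed

end

section \<open>Self-couplings and the topological lens\<close>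

lemma C2D:
  assumes "\<rho> \<in> C2 M"
  shows "sets \<rho> = sets (M \<Otimes>\<^sub>M M)" "prob_space \<rho>" "distr \<rho> M fst = M" "distr \<rho> M snd = M"
    "space \<rho> = space M \<times> space M"
  using assms sets_eq_imp_space_eq[of \<rho> "M \<Otimes>\<^sub>M M"] by (auto simp: C2_def space_pair_measure)

lemma topspace_C2_topology: "topspace (C2_topology M) = C2 M"
proof -
  have "C2 M = {\<rho>\<in>C2 M. measure \<rho> ({} \<times> {}) \<in> UNIV}" by simp
  then show ?thesis unfolding C2_topology_def topology_generated_by_topspace by blast
qed

lemma continuous_map_measure_rectangle:
  assumes "A \<in> sets M" "B \<in> sets M"
  shows "continuous_map (C2_topology M) euclideanreal (\<lambda>\<rho>. measure \<rho> (A \<times> B))"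
proof -
  have "openin (C2_topology M) {\<rho>\<in>C2 M. measure \<rho> (A \<times> B) \<in> U}" if "open U" for U
    unfolding C2_topology_def using assms that by (intro topology_generated_by_Basis) blast
  then show ?thesis by (simp add: continuous_map topspace_C2_topology)
qed

lemma lens_in_C2:
  assumes [measurable]: "T \<in> M \<rightarrow>\<^sub>M M" and T: "distr M M T = M" and \<rho>: "\<rho> \<in> C2 M"
  shows "lens M T \<rho> \<in> C2 M"
proof -
  note [measurable_cong] = C2D(1)[OF \<rho>]
  interpret prob_space \<rho> using \<rho> by (rule C2D)
  have "distr (lens M T \<rho>) M fst = distr (distr \<rho> M fst) M T"
    unfolding lens_def by (subst (1 2) distr_distr) (auto intro!: distr_cong)
  moreover have "distr (lens M T \<rho>) M snd = distr (distr \<rho> M snd) M T"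
    unfolding lens_def by (subst (1 2) distr_distr) (auto intro!: distr_cong)
  moreover have "prob_space (lens M T \<rho>)"
    unfolding lens_def by (rule prob_space_distr) measurable
  ultimately show ?thesis
    using T C2D(3,4)[OF \<rho>] by (simp add: C2_def lens_def)
qed

lemma lens_funpow_in_C2:
  assumes "T \<in> M \<rightarrow>\<^sub>M M" "distr M M T = M" "\<rho> \<in> C2 M"
  shows "(lens M T ^^ n) \<rho> \<in> C2 M"
  by (induction n) (auto intro: lens_in_C2 assms)

lemma measure_lens_funpow:
  assumes [measurable]: "T \<in> M \<rightarrow>\<^sub>M M" and \<rho>: "\<rho> \<in> C2 M"
    and [measurable]: "A \<in> sets M" "B \<in> sets M"
  shows "measure ((lens M T ^^ n) \<rho>) (A \<times> B)
    = measure \<rho> (((T ^^ n) -` A \<inter> space M) \<times> ((T ^^ n) -` B \<inter> space M))"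
proof -
  note [measurable_cong] = C2D(1)[OF \<rho>]
  have Tn [measurable]: "(T ^^ k) \<in> M \<rightarrow>\<^sub>M M" for k
    by (induction k) (simp_all add: measurable_comp)
  have "(lens M T ^^ n) \<rho> = distr \<rho> (M \<Otimes>\<^sub>M M) (\<lambda>(x, y). ((T ^^ n) x, (T ^^ n) y))"
  proof (induction n)
    case 0
    then show ?case using C2D(1)[OF \<rho>] by (simp add: distr_id2 case_prod_beta')
  next
    case (Suc n)
    then show ?case
      by (simp add: lens_def[of M T "distr _ _ _"]) (subst distr_distr, auto intro!: distr_cong)
  qed
  then show ?thesis
    using measurable_space[OF Tn]
    by (simp, subst measure_distr) (auto simp: C2D(5)[OF \<rho>] intro!: arg_cong[where f="measure \<rho>"])
qed

text \<open>The domination by a single finite measure \<^term>\<open>K\<close> makes the approximation of a countable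
  disjoint union by its finite parts uniform in \<^term>\<open>z\<close>.\<close>

lemma continuous_map_measure_vimage:
  fixes N :: "'z \<Rightarrow> 'b measure" and X :: "'z topology"
  assumes fin: "\<And>z. z \<in> topspace X \<Longrightarrow> finite_measure (N z)"
    and sets_N: "\<And>z. z \<in> topspace X \<Longrightarrow> sets (N z) = sets N0"
    and f: "f \<in> N0 \<rightarrow>\<^sub>M A1 \<Otimes>\<^sub>M A2" and H: "H \<in> sets N0"
    and K: "finite_measure K" "sets K = sets (A1 \<Otimes>\<^sub>M A2)"
    and dom: "\<And>z F. z \<in> topspace X \<Longrightarrow> F \<in> sets (A1 \<Otimes>\<^sub>M A2) \<Longrightarrow> measure (N z) (f -` F \<inter> H) \<le> measure K F"
    and rect: "\<And>A B. A \<in> sets A1 \<Longrightarrow> B \<in> sets A2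
        \<Longrightarrow> continuous_map X euclideanreal (\<lambda>z. measure (N z) (f -` (A \<times> B) \<inter> H))"
    and F: "F \<in> sets (A1 \<Otimes>\<^sub>M A2)"
  shows "continuous_map X euclideanreal (\<lambda>z. measure (N z) (f -` F \<inter> H))"
proof -
  have vim: "f -` G \<inter> H \<in> sets N0" if "G \<in> sets (A1 \<Otimes>\<^sub>M A2)" for G
  proof -
    have "f -` G \<inter> H = (f -` G \<inter> space N0) \<inter> H" using sets.sets_into_space[OF H] by auto
    then show ?thesis using f H that by (auto intro: measurable_sets)
  qed
  have sigma: "sets (A1 \<Otimes>\<^sub>M A2) = sigma_sets (space A1 \<times> space A2) {a \<times> b |a b. a \<in> sets A1 \<and> b \<in> sets A2}"
    by (rule sets_pair_measure)
  \<comment> \<open>Rectangles form an intersection-stable generator, and the measurable sets with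
    continuous evaluation form a Dynkin system containing them.\<close>
  show ?thesis
    using Int_stable_pair_measure_generator pair_measure_closed F
    unfolding sigma
  proof (induct rule: sigma_sets_induct_disjoint)
    case (basic G)
    then show ?case using rect by auto
  next
    case empty
    show ?case by simp
  next
    case (compl G)
    then have G: "G \<in> sets (A1 \<Otimes>\<^sub>M A2)" by (simp add: sigma)
    let ?S = "space A1 \<times> space A2"
    have "continuous_map X euclideanreal
        (\<lambda>z. measure (N z) (f -` ?S \<inter> H) - measure (N z) (f -` G \<inter> H))"
      by (intro continuous_map_diff rect compl) auto
    then show ?case
    proof (rule continuous_map_eq)
      fix z assume z: "z \<in> topspace X"
      interpret finite_measure "N z" by (rule fin[OF z])
      have "f -` (?S - G) \<inter> H = (f -` ?S \<inter> H) - (f -` G \<inter> H)" by auto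
      moreover have "G \<subseteq> ?S" using sets.sets_into_space[OF G] by (simp add: space_pair_measure)
      ultimately show "measure (N z) (f -` ?S \<inter> H) - measure (N z) (f -` G \<inter> H)
          = measure (N z) (f -` (?S - G) \<inter> H)"
        using vim[OF G] vim[of ?S] sets_N[OF z] by (subst finite_measure_Diff[symmetric]) auto
    qed
  next
    case (union G)
    then have G: "range G \<subseteq> sets (A1 \<Otimes>\<^sub>M A2)" by (simp add: sigma)
    interpret K: finite_measure K by (rule K)
    have sums_K: "(\<lambda>i. measure K (G i)) sums measure K (\<Union>i. G i)"
      using G K(2) union(1) by (intro K.finite_measure_UNION) auto
    show ?case
    proof (subst mtopology_is_euclidean[symmetric], rule Met_TC.continuous_map_uniform_limit_alt[where F=sequentially])
      show "\<forall>\<^sub>F n in sequentially. continuous_map X Met_TC.mtopology (\<lambda>z. \<Sum>i<n. measure (N z) (f -` G i \<inter> H))"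
        using union by (simp add: continuous_map_sum)
      fix e :: real assume "0 < e"
      have "(\<lambda>n. measure K (\<Union>i. G i) - (\<Sum>i<n. measure K (G i))) \<longlonglongrightarrow> measure K (\<Union>i. G i) - measure K (\<Union>i. G i)"
        using sums_K unfolding sums_def by (intro tendsto_intros)
      then have "\<forall>\<^sub>F n in sequentially. measure K (\<Union>i. G i) - (\<Sum>i<n. measure K (G i)) < e"
        using \<open>0 < e\<close> by (auto dest: order_tendstoD(2))
      then show "\<forall>\<^sub>F n in sequentially. \<forall>z\<in>topspace X.
          dist (\<Sum>i<n. measure (N z) (f -` G i \<inter> H)) (measure (N z) (f -` (\<Union>i. G i) \<inter> H)) < e"
      proof (eventually_elim, intro ballI)
        fix n z
        assume elim: "measure K (\<Union>i. G i) - (\<Sum>i<n. measure K (G i)) < e" "z \<in> topspace X"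
        interpret finite_measure "N z" by (rule fin[OF elim(2)])
        let ?P = "\<Union>i<n. G i"
        have mG: "G i \<in> sets (A1 \<Otimes>\<^sub>M A2)" for i using G by auto
        have P: "?P \<in> sets (A1 \<Otimes>\<^sub>M A2)" "(\<Union>i. G i) \<in> sets (A1 \<Otimes>\<^sub>M A2)" using mG by auto
        have disj: "disjoint_family_on G {..<n}"
          using union(1) by (auto simp: disjoint_family_on_def)
        have "(\<Sum>i<n. measure (N z) (f -` G i \<inter> H)) = measure (N z) (\<Union>i<n. f -` G i \<inter> H)"
        proof (rule finite_measure_finite_Union[symmetric])
          show "disjoint_family_on (\<lambda>i. f -` G i \<inter> H) {..<n}"
            using disj unfolding disjoint_family_on_def by blast
        qed (use vim[OF mG] sets_N[OF elim(2)] in auto)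
        also have "(\<Union>i<n. f -` G i \<inter> H) = f -` ?P \<inter> H" by auto
        finally have 1: "(\<Sum>i<n. measure (N z) (f -` G i \<inter> H)) = measure (N z) (f -` ?P \<inter> H)" .
        have "measure (N z) (f -` (\<Union>i. G i) \<inter> H) - measure (N z) (f -` ?P \<inter> H)
            = measure (N z) (f -` (\<Union>i. G i) \<inter> H - f -` ?P \<inter> H)"
          using vim[OF P(1)] vim[OF P(2)] sets_N[OF elim(2)] by (subst finite_measure_Diff) auto
        also have "\<dots> = measure (N z) (f -` ((\<Union>i. G i) - ?P) \<inter> H)"
          by (rule arg_cong[where f="measure (N z)"]) auto
        also have "\<dots> \<le> measure K ((\<Union>i. G i) - ?P)"
          using P elim(2) by (intro dom) auto
        also have "\<dots> = measure K (\<Union>i. G i) - measure K ?P"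
          using P K(2) by (intro K.finite_measure_Diff) auto
        also have "measure K ?P = (\<Sum>i<n. measure K (G i))"
          using mG K(2) disj by (intro K.finite_measure_finite_Union) auto
        finally have 2: "measure (N z) (f -` (\<Union>i. G i) \<inter> H) - measure (N z) (f -` ?P \<inter> H) < e"
          using elim by simp
        have "measure (N z) (f -` ?P \<inter> H) \<le> measure (N z) (f -` (\<Union>i. G i) \<inter> H)"
          using vim[OF P(2)] sets_N[OF elim(2)] by (intro finite_measure_mono) auto
        with 1 2 show "dist (\<Sum>i<n. measure (N z) (f -` G i \<inter> H)) (measure (N z) (f -` (\<Union>i. G i) \<inter> H)) < e"
          by (simp add: dist_real_def)
      qed
    qed auto
  qed
qed

section \<open>Fibre products and their continuity in the self-coupling\<close>

text \<open>The section over \<open>z\<close> is the rectangle of the two fibres over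
  \<open>z\<close>, so the measure of this set under \<open>M \<Otimes>\<^sub>M \<rho>\<close> is
  the integral over \<open>z\<close> of the \<rho>-measure of that rectangle. Two separate arguments
  allow rectangles to be replaced by general sets one factor at a time.\<close>

definition fibre_product :: "('a \<times> 'b) set \<Rightarrow> ('a \<times> 'c) set \<Rightarrow> ('a \<times> 'b \<times> 'c) set" where
  "fibre_product F G = {(z, x, y). (z, x) \<in> F \<and> (z, y) \<in> G}"

context prob_space
begin

lemma sets_pair_C2: "\<rho> \<in> C2 M \<Longrightarrow> sets (M \<Otimes>\<^sub>M \<rho>) = sets (M \<Otimes>\<^sub>M (M \<Otimes>\<^sub>M M))"
  by (intro sets_pair_measure_cong C2D) simp_all

lemma fibre_product_measurable:
  assumes [measurable]: "F \<in> sets (M \<Otimes>\<^sub>M M)" "G \<in> sets (M \<Otimes>\<^sub>M M)"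
  shows "fibre_product F G \<in> sets (M \<Otimes>\<^sub>M (M \<Otimes>\<^sub>M M))"
proof -
  have "fibre_product F G = {p \<in> space (M \<Otimes>\<^sub>M (M \<Otimes>\<^sub>M M)). (fst p, fst (snd p)) \<in> F \<and> (fst p, snd (snd p)) \<in> G}"
    using sets.sets_into_space[OF assms(1)] sets.sets_into_space[OF assms(2)]
    by (auto simp: fibre_product_def space_pair_measure)
  also have "\<dots> \<in> sets (M \<Otimes>\<^sub>M (M \<Otimes>\<^sub>M M))" by measurable
  finally show ?thesis .
qed

text \<open>Both marginals of \<rho> are \<open>M\<close>, so each of the two projections carries
  \<open>M \<Otimes>\<^sub>M \<rho>\<close> to \<open>M \<Otimes>\<^sub>M M\<close>. As the value is
  independent of \<rho>, it can serve as the dominating measure in the continuity argument.\<close>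

lemma measure_pair_C2_vimage:
  assumes \<rho>: "\<rho> \<in> C2 M" and F [measurable]: "F \<in> sets (M \<Otimes>\<^sub>M M)"
  shows "measure (M \<Otimes>\<^sub>M \<rho>) ((\<lambda>(z, x, y). (z, x)) -` F \<inter> space (M \<Otimes>\<^sub>M \<rho>)) = measure (M \<Otimes>\<^sub>M M) F"
    and "measure (M \<Otimes>\<^sub>M \<rho>) ((\<lambda>(z, x, y). (z, y)) -` F \<inter> space (M \<Otimes>\<^sub>M \<rho>)) = measure (M \<Otimes>\<^sub>M M) F"
proof -
  note [measurable_cong] = C2D(1)[OF \<rho>]
  have s: "sigma_finite_measure M" by unfold_locales
  have "distr (M \<Otimes>\<^sub>M \<rho>) (M \<Otimes>\<^sub>M M) (\<lambda>(z, q). (id z, fst q)) = distr M M id \<Otimes>\<^sub>M distr \<rho> M fst"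
    using s by (intro pair_measure_distr[symmetric]) (simp_all add: C2D(3)[OF \<rho>])
  also have "\<dots> = M \<Otimes>\<^sub>M M" by (simp add: C2D(3)[OF \<rho>] id_def)
  finally have 1: "distr (M \<Otimes>\<^sub>M \<rho>) (M \<Otimes>\<^sub>M M) (\<lambda>(z, x, y). (z, x)) = M \<Otimes>\<^sub>M M"
    by (simp add: case_prod_beta')
  have "distr (M \<Otimes>\<^sub>M \<rho>) (M \<Otimes>\<^sub>M M) (\<lambda>(z, q). (id z, snd q)) = distr M M id \<Otimes>\<^sub>M distr \<rho> M snd"
    using s by (intro pair_measure_distr[symmetric]) (simp_all add: C2D(4)[OF \<rho>])
  also have "\<dots> = M \<Otimes>\<^sub>M M" by (simp add: C2D(4)[OF \<rho>] id_def)
  finally have 2: "distr (M \<Otimes>\<^sub>M \<rho>) (M \<Otimes>\<^sub>M M) (\<lambda>(z, x, y). (z, y)) = M \<Otimes>\<^sub>M M"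
    by (simp add: case_prod_beta')
  show "measure (M \<Otimes>\<^sub>M \<rho>) ((\<lambda>(z, x, y). (z, x)) -` F \<inter> space (M \<Otimes>\<^sub>M \<rho>)) = measure (M \<Otimes>\<^sub>M M) F"
    using 1 by (subst measure_distr[symmetric, of _ _ "M \<Otimes>\<^sub>M M"]) auto
  show "measure (M \<Otimes>\<^sub>M \<rho>) ((\<lambda>(z, x, y). (z, y)) -` F \<inter> space (M \<Otimes>\<^sub>M \<rho>)) = measure (M \<Otimes>\<^sub>M M) F"
    using 2 by (subst measure_distr[symmetric, of _ _ "M \<Otimes>\<^sub>M M"]) auto
qed

text \<open>The topology tests only rectangles, for which the value is a constant times \<rho> of a
  rectangle. The continuity criterion is then applied twice with dominating measure
  \<open>M \<Otimes>\<^sub>M M\<close>: first to replace a rectangle by \<open>F\<close>, then, with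
  \<open>F\<close> fixed, to replace the other one by \<open>G\<close>.\<close>

lemma continuous_map_fibre_product:
  assumes F: "F \<in> sets (M \<Otimes>\<^sub>M M)" and G: "G \<in> sets (M \<Otimes>\<^sub>M M)"
  shows "continuous_map (C2_topology M) euclideanreal (\<lambda>\<rho>. measure (M \<Otimes>\<^sub>M \<rho>) (fibre_product F G))"
proof -
  let ?N0 = "M \<Otimes>\<^sub>M (M \<Otimes>\<^sub>M M)"
  let ?f = "\<lambda>(z, x, y). (z, x)" and ?g = "\<lambda>(z, x, y). (z, y)"
  have fin: "finite_measure (M \<Otimes>\<^sub>M \<rho>)" if "\<rho> \<in> C2 M" for \<rho>
    using prob_space_pair[OF prob_space_axioms C2D(2)[OF that]] by (rule prob_space.finite_measure)
  have finM: "finite_measure (M \<Otimes>\<^sub>M M)"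
    using prob_space_pair[OF prob_space_axioms prob_space_axioms] by (rule prob_space.finite_measure)
  have sp: "space (M \<Otimes>\<^sub>M \<rho>) = space ?N0" if "\<rho> \<in> C2 M" for \<rho>
    by (rule sets_eq_imp_space_eq[OF sets_pair_C2[OF that]])
  have f: "?f \<in> ?N0 \<rightarrow>\<^sub>M M \<Otimes>\<^sub>M M" and g: "?g \<in> ?N0 \<rightarrow>\<^sub>M M \<Otimes>\<^sub>M M" by measurable
  have fp: "fibre_product F' G' = ?f -` F' \<inter> (?g -` G' \<inter> space ?N0)"
    if "F' \<in> sets (M \<Otimes>\<^sub>M M)" "G' \<in> sets (M \<Otimes>\<^sub>M M)" for F' G'
    using sets.sets_into_space[OF that(1)] sets.sets_into_space[OF that(2)]
    by (auto simp: fibre_product_def space_pair_measure)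
  have fp': "fibre_product F' G' = ?g -` G' \<inter> (?f -` F' \<inter> space ?N0)"
    if "F' \<in> sets (M \<Otimes>\<^sub>M M)" "G' \<in> sets (M \<Otimes>\<^sub>M M)" for F' G'
    using fp[OF that] by auto
  \<comment> \<open>A fibre product lies in the preimage of either factor under the corresponding
    projection.\<close>
  have dom: "measure (M \<Otimes>\<^sub>M \<rho>) (fibre_product F' G') \<le> measure (M \<Otimes>\<^sub>M M) F'"
      "measure (M \<Otimes>\<^sub>M \<rho>) (fibre_product F' G') \<le> measure (M \<Otimes>\<^sub>M M) G'"
    if \<rho>: "\<rho> \<in> C2 M" and F': "F' \<in> sets (M \<Otimes>\<^sub>M M)" and G': "G' \<in> sets (M \<Otimes>\<^sub>M M)" for \<rho> F' G'
  proof -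
    note [measurable_cong] = C2D(1)[OF \<rho>]
    interpret R: finite_measure "M \<Otimes>\<^sub>M \<rho>" by (rule fin[OF \<rho>])
    have "fibre_product F' G' \<subseteq> ?f -` F' \<inter> space (M \<Otimes>\<^sub>M \<rho>)" "?f -` F' \<inter> space (M \<Otimes>\<^sub>M \<rho>) \<in> sets (M \<Otimes>\<^sub>M \<rho>)"
      using fp[OF F' G'] sp[OF \<rho>] measurable_sets[OF f F'] sets_pair_C2[OF \<rho>] by auto
    from R.finite_measure_mono[OF this]
    show "measure (M \<Otimes>\<^sub>M \<rho>) (fibre_product F' G') \<le> measure (M \<Otimes>\<^sub>M M) F'"
      by (simp only: measure_pair_C2_vimage[OF \<rho> F'])
    have "fibre_product F' G' \<subseteq> ?g -` G' \<inter> space (M \<Otimes>\<^sub>M \<rho>)" "?g -` G' \<inter> space (M \<Otimes>\<^sub>M \<rho>) \<in> sets (M \<Otimes>\<^sub>M \<rho>)"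
      using fp[OF F' G'] sp[OF \<rho>] measurable_sets[OF g G'] sets_pair_C2[OF \<rho>] by auto
    from R.finite_measure_mono[OF this]
    show "measure (M \<Otimes>\<^sub>M \<rho>) (fibre_product F' G') \<le> measure (M \<Otimes>\<^sub>M M) G'"
      by (simp only: measure_pair_C2_vimage[OF \<rho> G'])
  qed
  have rect: "continuous_map (C2_topology M) euclideanreal
      (\<lambda>\<rho>. measure (M \<Otimes>\<^sub>M \<rho>) (fibre_product (A \<times> C) (B \<times> D)))"
    if "A \<in> sets M" "B \<in> sets M" "C \<in> sets M" "D \<in> sets M" for A B C D
  proof (rule continuous_map_eq)
    show "continuous_map (C2_topology M) euclideanreal (\<lambda>\<rho>. measure M (A \<inter> B) * measure \<rho> (C \<times> D))"
      using that by (intro continuous_map_real_mult continuous_map_measure_rectangle) auto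
    fix \<rho> assume "\<rho> \<in> topspace (C2_topology M)"
    then have \<rho>: "\<rho> \<in> C2 M" by (simp add: topspace_C2_topology)
    interpret R: prob_space \<rho> by (rule C2D[OF \<rho>])
    have "fibre_product (A \<times> C) (B \<times> D) = (A \<inter> B) \<times> (C \<times> D)" by (auto simp: fibre_product_def)
    then show "measure M (A \<inter> B) * measure \<rho> (C \<times> D) = measure (M \<Otimes>\<^sub>M \<rho>) (fibre_product (A \<times> C) (B \<times> D))"
      using that C2D(1)[OF \<rho>] by (simp add: measure_def R.emeasure_pair_measure_Times enn2real_mult)
  qed
  have rectG: "continuous_map (C2_topology M) euclideanreal
      (\<lambda>\<rho>. measure (M \<Otimes>\<^sub>M \<rho>) (fibre_product F (B \<times> D)))"
    if "B \<in> sets M" "D \<in> sets M" for B D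
  proof -
    have BD: "B \<times> D \<in> sets (M \<Otimes>\<^sub>M M)" using that by auto
    have "continuous_map (C2_topology M) euclideanreal
        (\<lambda>\<rho>. measure (M \<Otimes>\<^sub>M \<rho>) (?f -` F \<inter> (?g -` (B \<times> D) \<inter> space ?N0)))"
    proof (rule continuous_map_measure_vimage[OF _ _ f _ finM refl _ _ F])
      show "?g -` (B \<times> D) \<inter> space ?N0 \<in> sets ?N0" by (rule measurable_sets[OF g BD])
    qed (use that BD fin sets_pair_C2 dom(1) rect in \<open>auto simp only: topspace_C2_topology fp[symmetric] pair_measureI\<close>)
    then show ?thesis using F BD by (simp only: fp)
  qed
  have "continuous_map (C2_topology M) euclideanreal
      (\<lambda>\<rho>. measure (M \<Otimes>\<^sub>M \<rho>) (?g -` G \<inter> (?f -` F \<inter> space ?N0)))"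
  proof (rule continuous_map_measure_vimage[OF _ _ g _ finM refl _ _ G])
    show "?f -` F \<inter> space ?N0 \<in> sets ?N0" by (rule measurable_sets[OF f F])
  qed (use F fin sets_pair_C2 dom(2) rectG in \<open>auto simp only: topspace_C2_topology fp'[symmetric] pair_measureI\<close>)
  then show ?thesis using F G by (simp only: fp')
qed

lemma measure_pair_eq_integral:
  assumes N: "prob_space N" and Q: "Q \<in> sets (M \<Otimes>\<^sub>M N)"
  shows "measure (M \<Otimes>\<^sub>M N) Q = (\<integral>z. measure N (Pair z -` Q) \<partial>M)"
proof -
  interpret N: prob_space N by (rule N)
  have [measurable]: "(\<lambda>z. measure N (Pair z -` Q)) \<in> borel_measurable M"
    unfolding measure_def using N.measurable_emeasure_Pair[OF Q] by measurable
  have int: "integrable M (\<lambda>z. measure N (Pair z -` Q))"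
    by (intro integrable_const_bound[where B=1]) auto
  have "emeasure (M \<Otimes>\<^sub>M N) Q = (\<integral>\<^sup>+z. ennreal (measure N (Pair z -` Q)) \<partial>M)"
    by (simp add: N.emeasure_pair_measure_alt[OF Q] N.emeasure_eq_measure)
  also have "\<dots> = ennreal (\<integral>z. measure N (Pair z -` Q) \<partial>M)"
    using int by (intro nn_integral_eq_integral) auto
  finally show ?thesis by (simp add: measure_def integral_nonneg_AE)
qed

lemma diagonal_in_C2: "distr M (M \<Otimes>\<^sub>M M) (\<lambda>x. (x, x)) \<in> C2 M"
  by (auto simp: C2_def distr_distr comp_def distr_id2 intro!: prob_space_distr)

lemma pair_measure_in_C2: "M \<Otimes>\<^sub>M M \<in> C2 M"
proof -
  interpret S: pair_sigma_finite M M by unfold_locales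
  have "distr (M \<Otimes>\<^sub>M M) M snd = distr (distr (M \<Otimes>\<^sub>M M) (M \<Otimes>\<^sub>M M) (\<lambda>(x, y). (y, x))) M snd"
    using S.distr_pair_swap by simp
  also have "\<dots> = distr (M \<Otimes>\<^sub>M M) M fst"
    by (subst distr_distr) (auto intro!: distr_cong)
  finally show ?thesis
    using prob_space_pair[OF prob_space_axioms prob_space_axioms] distr_pair_fst[of M] by (simp add: C2_def)
qed

end

text \<open>For values in the unit interval \<open>f - f\<^sup>2\<close> is nonnegative. Here its
  integral is 0, so it vanishes almost everywhere.\<close>

lemma (in prob_space) integral_square_eq_imp_AE:
  assumes [measurable]: "f \<in> borel_measurable M" and bd: "\<And>x. 0 \<le> f x \<and> f x \<le> (1::real)"
    and eq: "(\<integral>x. f x \<partial>M) = (\<integral>x. (f x)\<^sup>2 \<partial>M)"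
  shows "AE x in M. f x = 0 \<or> f x = 1"
proof -
  have int: "integrable M f" "integrable M (\<lambda>x. (f x)\<^sup>2)"
    using bd by (auto intro!: integrable_const_bound[where B=1] simp: power_le_one)
  have nonneg: "0 \<le> f x - (f x)\<^sup>2" for x
    using bd[of x] mult_left_le[of "f x" "f x"] by (simp add: power2_eq_square)
  have "(\<integral>x. f x - (f x)\<^sup>2 \<partial>M) = 0" using int eq by simp
  then have "AE x in M. f x - (f x)\<^sup>2 = 0"
    using int nonneg by (subst (asm) integral_nonneg_eq_0_iff_AE) auto
  then show ?thesis by eventually_elim (simp add: power2_eq_square)
qed

section \<open>From transitivity of the lens to weak mixing, through ergodicity of the
  square\<close>

context measure_preserving_system
begin

text \<open>Since \<open>T\<close> preserves \<open>M\<close> in the base variable too,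
  \<open>M \<Otimes>\<^sub>M lens M T \<rho>\<close> is the image of
  \<open>M \<Otimes>\<^sub>M \<rho>\<close> under \<open>T\<close> acting on all three coordinates.
  This action pulls \<open>fibre_product F F\<close> back to itself, because \<open>F\<close> is
  invariant.\<close>

lemma measure_fibre_product_lens:
  assumes \<rho>: "\<rho> \<in> C2 M" and F: "F \<in> sets (M \<Otimes>\<^sub>M M)"
    and inv: "(\<lambda>(x, y). (T x, T y)) -` F \<inter> space (M \<Otimes>\<^sub>M M) = F"
  shows "measure (M \<Otimes>\<^sub>M lens M T \<rho>) (fibre_product F F) = measure (M \<Otimes>\<^sub>M \<rho>) (fibre_product F F)"
proof -
  note [measurable_cong] = C2D(1)[OF \<rho>]
  have lens: "lens M T \<rho> \<in> C2 M" by (rule lens_in_C2[OF T_measurable distr_T \<rho>])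
  interpret L: prob_space "lens M T \<rho>" by (rule C2D[OF lens])
  let ?S = "\<lambda>(z, q). (T z, (\<lambda>(x, y). (T x, T y)) q)"
  have "M \<Otimes>\<^sub>M lens M T \<rho> = distr M M T \<Otimes>\<^sub>M lens M T \<rho>" by (simp add: distr_T)
  also have "\<dots> = distr (M \<Otimes>\<^sub>M \<rho>) (M \<Otimes>\<^sub>M (M \<Otimes>\<^sub>M M)) ?S"
    unfolding lens_def
    by (rule pair_measure_distr) (auto simp: lens_def[symmetric] L.sigma_finite_measure_axioms)
  finally have "measure (M \<Otimes>\<^sub>M lens M T \<rho>) (fibre_product F F)
      = measure (M \<Otimes>\<^sub>M \<rho>) (?S -` fibre_product F F \<inter> space (M \<Otimes>\<^sub>M \<rho>))"
    using fibre_product_measurable[OF F F] by (simp, subst measure_distr) auto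
  also have "?S -` fibre_product F F \<inter> space (M \<Otimes>\<^sub>M \<rho>) = fibre_product F F"
    using inv by (fastforce simp: fibre_product_def space_pair_measure C2D(5)[OF \<rho>])
  finally show ?thesis .
qed

lemma transitive_lens_imp_ergodic_product:
  assumes erg: "ergodic M T" and trans: "top_transitive (C2_topology M) (lens M T)"
  shows "ergodic (M \<Otimes>\<^sub>M M) (\<lambda>(x, y). (T x, T y))"
  unfolding ergodic_def
proof (intro ballI impI)
  fix F assume F: "F \<in> sets (M \<Otimes>\<^sub>M M)"
    and inv: "(\<lambda>(x, y). (T x, T y)) -` F \<inter> space (M \<Otimes>\<^sub>M M) = F"
  define \<Phi> where "\<Phi> \<rho> = measure (M \<Otimes>\<^sub>M \<rho>) (fibre_product F F)" for \<rho>
  define \<phi> where "\<phi> z = measure M (Pair z -` F)" for z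
  let ?\<Delta> = "distr M (M \<Otimes>\<^sub>M M) (\<lambda>x. (x, x))"
  have [measurable]: "\<phi> \<in> borel_measurable M"
    unfolding \<phi>_def measure_def using measurable_emeasure_Pair[OF F] by measurable
  have \<Phi>_diag: "\<Phi> ?\<Delta> = measure (M \<Otimes>\<^sub>M M) F"
  proof -
    interpret D: prob_space ?\<Delta> by (rule C2D(2)[OF diagonal_in_C2])
    have "M \<Otimes>\<^sub>M ?\<Delta> = distr M M id \<Otimes>\<^sub>M ?\<Delta>" by (simp add: id_def)
    also have "\<dots> = distr (M \<Otimes>\<^sub>M M) (M \<Otimes>\<^sub>M (M \<Otimes>\<^sub>M M)) (\<lambda>(z, x). (id z, (x, x)))"
      by (rule pair_measure_distr) (auto simp: D.sigma_finite_measure_axioms)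
    finally have "\<Phi> ?\<Delta> = measure (M \<Otimes>\<^sub>M M) ((\<lambda>(z, x). (id z, (x, x))) -` fibre_product F F \<inter> space (M \<Otimes>\<^sub>M M))"
      unfolding \<Phi>_def using fibre_product_measurable[OF F F] by (simp, subst measure_distr) auto
    \<comment> \<open>A diagonal pair \<open>(x, x)\<close> lies in the square of a fibre exactly
      when \<open>x\<close> lies in the fibre.\<close>
    also have "(\<lambda>(z, x). (id z, (x, x))) -` fibre_product F F \<inter> space (M \<Otimes>\<^sub>M M) = F"
      using sets.sets_into_space[OF F] by (auto simp: fibre_product_def)
    finally show ?thesis .
  qed
  have int_\<phi>: "measure (M \<Otimes>\<^sub>M M) F = (\<integral>z. \<phi> z \<partial>M)"
    unfolding \<phi>_def by (rule measure_pair_eq_integral[OF prob_space_axioms F])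
  have \<Phi>_prod: "\<Phi> (M \<Otimes>\<^sub>M M) = (\<integral>z. (\<phi> z)\<^sup>2 \<partial>M)"
  proof -
    have "\<Phi> (M \<Otimes>\<^sub>M M) = (\<integral>z. measure (M \<Otimes>\<^sub>M M) (Pair z -` fibre_product F F) \<partial>M)"
      unfolding \<Phi>_def
      by (rule measure_pair_eq_integral[OF prob_space_pair[OF prob_space_axioms prob_space_axioms]
            fibre_product_measurable[OF F F]])
    also have "\<dots> = (\<integral>z. (\<phi> z)\<^sup>2 \<partial>M)"
    proof (rule Bochner_Integration.integral_cong[OF refl])
      fix z
      have "Pair z -` fibre_product F F = (Pair z -` F) \<times> (Pair z -` F)" by (auto simp: fibre_product_def)
      then show "measure (M \<Otimes>\<^sub>M M) (Pair z -` fibre_product F F) = (\<phi> z)\<^sup>2"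
        using sets_Pair1[OF F, of z]
        by (simp add: \<phi>_def measure_def emeasure_pair_measure_Times enn2real_mult power2_eq_square)
    qed
    finally show ?thesis .
  qed
  have \<Phi>_funpow: "\<Phi> ((lens M T ^^ n) \<rho>) = \<Phi> \<rho>" if "\<rho> \<in> C2 M" for \<rho> n
  proof (induction n)
    case (Suc n)
    then show ?case
      using measure_fibre_product_lens[OF lens_funpow_in_C2[OF T_measurable distr_T that] F inv]
      by (simp add: \<Phi>_def)
  qed simp
  have cont: "continuous_map (C2_topology M) euclideanreal \<Phi>"
    unfolding \<Phi>_def by (rule continuous_map_fibre_product[OF F F])
  \<comment> \<open>A level \<open>c\<close> strictly between two values would separate two nonempty
    open sets, below and above \<open>c\<close>. No orbit can pass from one to the other because
    \<Phi> is constant along orbits, contradicting transitivity.\<close>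
  have "\<Phi> \<rho> \<le> \<Phi> \<sigma>" if \<rho>: "\<rho> \<in> C2 M" and \<sigma>: "\<sigma> \<in> C2 M" for \<rho> \<sigma>
  proof (rule ccontr)
    assume "\<not> \<Phi> \<rho> \<le> \<Phi> \<sigma>"
    then obtain c where c: "\<Phi> \<sigma> < c" "c < \<Phi> \<rho>" using dense by (auto simp: not_le)
    let ?U = "{\<tau>\<in>C2 M. \<Phi> \<tau> \<in> {..<c}}" and ?V = "{\<tau>\<in>C2 M. \<Phi> \<tau> \<in> {c<..}}"
    have "openin (C2_topology M) ?U" "openin (C2_topology M) ?V"
      using openin_continuous_map_preimage[OF cont, of "{..<c}"]
        openin_continuous_map_preimage[OF cont, of "{c<..}"] by (simp_all add: topspace_C2_topology)
    moreover have "?U \<noteq> {}" "?V \<noteq> {}" using c \<rho> \<sigma> by auto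
    ultimately obtain n where "(lens M T ^^ n) -` ?U \<inter> ?V \<noteq> {}"
      using trans unfolding top_transitive_def by blast
    then show False using \<Phi>_funpow by auto
  qed
  then have "\<Phi> ?\<Delta> = \<Phi> (M \<Otimes>\<^sub>M M)"
    using diagonal_in_C2 pair_measure_in_C2 by (meson order_antisym)
  then have "(\<integral>z. \<phi> z \<partial>M) = (\<integral>z. (\<phi> z)\<^sup>2 \<partial>M)"
    by (simp add: \<Phi>_diag \<Phi>_prod int_\<phi>)
  then have 01: "AE z in M. \<phi> z = 0 \<or> \<phi> z = 1"
    by (intro integral_square_eq_imp_AE) (simp_all, simp add: \<phi>_def)
  let ?E = "{z\<in>space M. \<phi> z = 1}"
  \<comment> \<open>Invariance of \<open>F\<close> makes the fibre over \<open>z\<close> the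
    preimage under \<open>T\<close> of the fibre over \<open>T z\<close>, and \<open>T\<close>
    preserves measure.\<close>
  have \<phi>_T: "\<phi> (T z) = \<phi> z" if "z \<in> space M" for z
  proof -
    have "Pair z -` F = T -` (Pair (T z) -` F) \<inter> space M"
      using inv that sets.sets_into_space[OF F] by (fastforce simp: space_pair_measure)
    then show ?thesis
      using measure_vimage_funpow[of "Pair (T z) -` F" 1] sets_Pair1[OF F] by (simp add: \<phi>_def)
  qed
  have "T -` ?E \<inter> space M = ?E"
    using \<phi>_T measurable_space[OF T_measurable] by auto
  moreover have "?E \<in> sets M" by measurable
  ultimately have "prob ?E = 0 \<or> prob ?E = 1" using erg unfolding ergodic_def by blast
  \<comment> \<open>By the zero-one property \<phi> is almost surely the indicator of
    \<open>?E\<close>, so the measure of \<open>F\<close> equals that of an invariant set of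
    \<open>T\<close>.\<close>
  moreover have "(\<integral>z. \<phi> z \<partial>M) = (\<integral>z. indicator ?E z \<partial>M)"
    using 01 AE_space by (intro integral_cong_AE) (auto elim: eventually_elim2)
  ultimately show "measure (M \<Otimes>\<^sub>M M) F = 0 \<or> measure (M \<Otimes>\<^sub>M M) F = 1"
    by (simp add: int_\<phi>)
qed

lemma product_system: "measure_preserving_system (M \<Otimes>\<^sub>M M) (\<lambda>(x, y). (T x, T y))"
proof -
  have "distr (M \<Otimes>\<^sub>M M) (M \<Otimes>\<^sub>M M) (\<lambda>(x, y). (T x, T y)) = M \<Otimes>\<^sub>M M"
    using pair_measure_distr[of T M M T M M] by (simp add: distr_T sigma_finite_measure_axioms)
  then show ?thesis
    using prob_space_pair[OF prob_space_axioms prob_space_axioms]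
    by (auto simp: measure_preserving_system_def measure_preserving_system_axioms_def)
qed

text \<open>The square of a correlation of \<open>T\<close> is a correlation of the product map for
  the rectangles \<open>A \<times> A\<close> and \<open>B \<times> B\<close>. Ergodicity of both
  maps thus gives the limits of the averages of \<open>a k\<close> and of its square.\<close>

lemma ergodic_product_imp_weakly_mixing:
  assumes erg: "ergodic M T" and erg2: "ergodic (M \<Otimes>\<^sub>M M) (\<lambda>(x, y). (T x, T y))"
  shows "weakly_mixing M T"
  unfolding weakly_mixing_def
proof (intro ballI)
  fix A B assume A [measurable]: "A \<in> sets M" and B [measurable]: "B \<in> sets M"
  let ?S = "\<lambda>(x, y). (T x, T y)"
  define a where "a k = measure M ((T ^^ k) -` A \<inter> B)" for k
  define \<alpha> where "\<alpha> = measure M A * measure M B"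
  interpret S: measure_preserving_system "M \<Otimes>\<^sub>M M" ?S by (rule product_system)
  have measure_Times: "measure (M \<Otimes>\<^sub>M M) (C \<times> C) = (measure M C)\<^sup>2" if "C \<in> sets M" for C
    using that by (simp add: measure_def emeasure_pair_measure_Times enn2real_mult power2_eq_square)
  have "(\<lambda>n. (\<Sum>k<n. a k) / real n) \<longlonglongrightarrow> \<alpha>"
    unfolding a_def \<alpha>_def by (rule ergodic_average_measure[OF erg A B])
  moreover have "(\<lambda>n. (\<Sum>k<n. (a k)\<^sup>2) / real n) \<longlonglongrightarrow> \<alpha>\<^sup>2"
  proof -
    have "(?S ^^ k) = (\<lambda>(x, y). ((T ^^ k) x, (T ^^ k) y))" for k
      by (induction k) auto
    then have "(?S ^^ k) -` (A \<times> A) \<inter> (B \<times> B) = ((T ^^ k) -` A \<inter> B) \<times> ((T ^^ k) -` A \<inter> B)" for k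
      by auto
    moreover have "(T ^^ k) -` A \<inter> B \<in> sets M" for k
      by (rule vimage_funpow_Int_measurable[OF A B])
    ultimately have "measure (M \<Otimes>\<^sub>M M) ((?S ^^ k) -` (A \<times> A) \<inter> (B \<times> B)) = (a k)\<^sup>2" for k
      by (simp add: measure_Times a_def)
    then show ?thesis
      using S.ergodic_average_measure[OF erg2, of "A \<times> A" "B \<times> B"]
      by (simp add: measure_Times \<alpha>_def power_mult_distrib)
  qed
  \<comment> \<open>This is the expanded mean of the squared deviations of \<open>a k\<close> from
    \<alpha>; its limit is 0.\<close>
  ultimately have lim: "(\<lambda>n. (\<Sum>k<n. (a k)\<^sup>2) / real n - 2 * \<alpha> * ((\<Sum>k<n. a k) / real n) + \<alpha>\<^sup>2)
      \<longlonglongrightarrow> \<alpha>\<^sup>2 - 2 * \<alpha> * \<alpha> + \<alpha>\<^sup>2"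
    by (intro tendsto_intros)
  have "(\<lambda>n. ((\<Sum>k<n. \<bar>a k - \<alpha>\<bar>) / real n)\<^sup>2) \<longlonglongrightarrow> 0"
  proof (rule tendsto_sandwich[OF _ _ tendsto_const])
    show "\<forall>\<^sub>F n in sequentially. ((\<Sum>k<n. \<bar>a k - \<alpha>\<bar>) / real n)\<^sup>2
        \<le> (\<Sum>k<n. (a k)\<^sup>2) / real n - 2 * \<alpha> * ((\<Sum>k<n. a k) / real n) + \<alpha>\<^sup>2"
    proof (rule eventually_sequentiallyI[of 1])
      fix n :: nat assume n: "1 \<le> n"
      \<comment> \<open>Cauchy-Schwarz passes from the quadratic mean to the mean absolute
        deviation.\<close>
      have "(\<Sum>k<n. \<bar>a k - \<alpha>\<bar>)\<^sup>2 \<le> (\<Sum>k<n. \<bar>a k - \<alpha>\<bar>\<^sup>2) * real n"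
        using sum_squared_le_sum_of_squares[of "\<lambda>k. \<bar>a k - \<alpha>\<bar>" "{..<n}"] by simp
      then have "((\<Sum>k<n. \<bar>a k - \<alpha>\<bar>) / real n)\<^sup>2 \<le> (\<Sum>k<n. (a k - \<alpha>)\<^sup>2) / real n"
        using n by (simp add: power_divide divide_simps power2_eq_square)
      also have "(\<Sum>k<n. (a k - \<alpha>)\<^sup>2) = (\<Sum>k<n. (a k)\<^sup>2) - 2 * \<alpha> * (\<Sum>k<n. a k) + real n * \<alpha>\<^sup>2"
        by (simp add: power2_diff sum.distrib sum_subtractf sum_distrib_left algebra_simps)
      finally show "((\<Sum>k<n. \<bar>a k - \<alpha>\<bar>) / real n)\<^sup>2
          \<le> (\<Sum>k<n. (a k)\<^sup>2) / real n - 2 * \<alpha> * ((\<Sum>k<n. a k) / real n) + \<alpha>\<^sup>2"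
        using n by (simp add: add_divide_distrib diff_divide_distrib)
    qed
  qed (use lim in \<open>auto simp: power2_eq_square\<close>)
  then have "(\<lambda>n. sqrt (((\<Sum>k<n. \<bar>a k - \<alpha>\<bar>) / real n)\<^sup>2)) \<longlonglongrightarrow> sqrt 0"
    by (rule tendsto_real_sqrt)
  then show "(\<lambda>n. (\<Sum>k<n. \<bar>measure M ((T ^^ k) -` A \<inter> B) - measure M A * measure M B\<bar>) / real n) \<longlonglongrightarrow> 0"
    unfolding real_sqrt_abs real_sqrt_zero tendsto_rabs_zero_iff a_def \<alpha>_def .
qed

end

section \<open>Couplings with prescribed block weights\<close>

text \<open>Blocks may be empty or null. This permits indexing by all subfamilies of a finite
  family, including those whose atom is empty.\<close>

definition measurable_partition :: "'a measure \<Rightarrow> 'i set \<Rightarrow> ('i \<Rightarrow> 'a set) \<Rightarrow> bool" where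
  "measurable_partition M I E \<longleftrightarrow> finite I \<and> (\<forall>i\<in>I. E i \<in> sets M) \<and> disjoint_family_on E I \<and> (\<Union>i\<in>I. E i) = space M"

lemma (in finite_measure) sum_measure_partition:
  assumes E: "measurable_partition M I E" and Q: "Q \<in> sets M"
  shows "(\<Sum>i\<in>I. measure M (Q \<inter> E i)) = measure M Q"
proof -
  have "(\<Sum>i\<in>I. measure M (Q \<inter> E i)) = measure M (\<Union>i\<in>I. Q \<inter> E i)"
    using E Q unfolding measurable_partition_def
    by (intro finite_measure_finite_Union[symmetric]) (auto simp: disjoint_family_on_def)
  also have "(\<Union>i\<in>I. Q \<inter> E i) = Q"
    using E sets.sets_into_space[OF Q] unfolding measurable_partition_def by auto
  finally show ?thesis .
qed

lemma sum_measure_C2_partition: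
  assumes E: "measurable_partition M I E" and \<rho>: "\<rho> \<in> C2 M" and A: "A \<in> sets M" and B: "B \<in> sets M"
  shows "(\<Sum>i\<in>I. \<Sum>j\<in>I. measure \<rho> ((A \<inter> E i) \<times> (B \<inter> E j))) = measure \<rho> (A \<times> B)"
proof -
  interpret prob_space \<rho> by (rule C2D[OF \<rho>])
  have "measurable_partition \<rho> (I \<times> I) (\<lambda>(i, j). E i \<times> E j)"
    unfolding measurable_partition_def C2D(5)[OF \<rho>] C2D(1)[OF \<rho>]
  proof (intro conjI)
    have disj: "E i \<inter> E j = {}" if "i \<in> I" "j \<in> I" "i \<noteq> j" for i j
      using E that unfolding measurable_partition_def disjoint_family_on_def by blast
    show "disjoint_family_on (\<lambda>(i, j). E i \<times> E j) (I \<times> I)"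
      unfolding disjoint_family_on_def
    proof (intro ballI impI)
      fix a b assume "a \<in> I \<times> I" "b \<in> I \<times> I" "a \<noteq> b"
      then have "E (fst a) \<inter> E (fst b) = {} \<or> E (snd a) \<inter> E (snd b) = {}"
        using disj by (metis mem_Times_iff prod.expand)
      then show "(case a of (i, j) \<Rightarrow> E i \<times> E j) \<inter> (case b of (i, j) \<Rightarrow> E i \<times> E j) = {}"
        by (auto simp: case_prod_beta)
    qed
    have "(\<Union>a\<in>I \<times> I. case a of (i, j) \<Rightarrow> E i \<times> E j) = (\<Union>i\<in>I. E i) \<times> (\<Union>j\<in>I. E j)" by blast
    then show "(\<Union>a\<in>I \<times> I. case a of (i, j) \<Rightarrow> E i \<times> E j) = space M \<times> space M"
      using E unfolding measurable_partition_def by simp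
  qed (use E in \<open>auto simp: measurable_partition_def\<close>)
  from sum_measure_partition[OF this, of "A \<times> B"] show ?thesis
    using A B C2D(1)[OF \<rho>] by (simp add: sum.cartesian_product case_prod_beta' Times_Int_Times)
qed

text \<open>The blocks are the atoms of the algebra generated by the family: a point is indexed by
  the subfamily of the sets that contain it.\<close>

lemma exists_partition_refining:
  fixes M :: "'a measure"
  assumes "finite \<A>" "\<A> \<subseteq> sets M"
  obtains I :: "'a set set set" and E where "measurable_partition M I E"
    "\<And>A i. A \<in> \<A> \<Longrightarrow> i \<in> I \<Longrightarrow> E i \<subseteq> A \<or> A \<inter> E i = {}"
proof
  let ?E = "\<lambda>i. {x\<in>space M. \<forall>A\<in>\<A>. x \<in> A \<longleftrightarrow> A \<in> i}"
  have "?E i \<in> sets M" for i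
  proof (rule sets.sets_Collect_finite_All[OF _ assms(1)])
    fix A assume "A \<in> \<A>"
    then have [measurable]: "A \<in> sets M" using assms(2) by auto
    show "{x\<in>space M. x \<in> A \<longleftrightarrow> A \<in> i} \<in> sets M" by measurable
  qed
  moreover have "(\<Union>i\<in>Pow \<A>. ?E i) = space M"
  proof (intro equalityI subsetI)
    fix x assume "x \<in> space M"
    then show "x \<in> (\<Union>i\<in>Pow \<A>. ?E i)" by (intro UN_I[of "{A\<in>\<A>. x \<in> A}"]) auto
  qed auto
  moreover have "disjoint_family_on ?E (Pow \<A>)"
    unfolding disjoint_family_on_def
  proof (intro ballI impI)
    fix i j assume "i \<in> Pow \<A>" "j \<in> Pow \<A>" "i \<noteq> j"
    then obtain A where "A \<in> \<A>" "(A \<in> i) \<noteq> (A \<in> j)" by blast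
    then show "?E i \<inter> ?E j = {}" by auto
  qed
  ultimately show "measurable_partition M (Pow \<A>) ?E"
    using assms(1) by (simp add: measurable_partition_def)
  show "?E i \<subseteq> A \<or> A \<inter> ?E i = {}" if "A \<in> \<A>" for A i
    using that by (cases "A \<in> i") auto
qed

section \<open>Self-couplings with block-constant densities\<close>

context prob_space
begin

text \<open>The coupling has density \<open>w a b\<close> on the block
  \<open>E a \<times> E b\<close> with respect to the product measure. The weighted row sums are the
  density of its first marginal, the column sums that of its second.\<close>

lemma coupling_of_block_matrix:
  assumes E: "measurable_partition M L E" and w: "\<And>a b. a \<in> L \<Longrightarrow> b \<in> L \<Longrightarrow> 0 \<le> w a b"
    and row: "\<And>a. a \<in> L \<Longrightarrow> (\<Sum>b\<in>L. w a b * prob (E b)) = 1"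
    and col: "\<And>b. b \<in> L \<Longrightarrow> (\<Sum>a\<in>L. w a b * prob (E a)) = 1"
  obtains \<sigma> where "\<sigma> \<in> C2 M"
    "\<And>A B. A \<in> sets M \<Longrightarrow> B \<in> sets M \<Longrightarrow>
      measure \<sigma> (A \<times> B) = (\<Sum>a\<in>L. \<Sum>b\<in>L. w a b * (prob (A \<inter> E a) * prob (B \<inter> E b)))"
proof
  have fin: "finite L" and mE: "\<And>a. a \<in> L \<Longrightarrow> E a \<in> sets M"
    using E by (auto simp: measurable_partition_def)
  define f where "f p = (\<Sum>a\<in>L. \<Sum>b\<in>L. ennreal (w a b) * indicator (E a \<times> E b) p)" for p
  define \<sigma> where "\<sigma> = density (M \<Otimes>\<^sub>M M) f"
  have f [measurable]: "f \<in> borel_measurable (M \<Otimes>\<^sub>M M)"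
    unfolding f_def using mE by measurable
  have em: "emeasure \<sigma> (A \<times> B) = ennreal (\<Sum>a\<in>L. \<Sum>b\<in>L. w a b * (prob (A \<inter> E a) * prob (B \<inter> E b)))"
    if A: "A \<in> sets M" and B: "B \<in> sets M" for A B
  proof -
    have "emeasure \<sigma> (A \<times> B) = (\<integral>\<^sup>+p. f p * indicator (A \<times> B) p \<partial>(M \<Otimes>\<^sub>M M))"
      unfolding \<sigma>_def using A B by (intro emeasure_density) auto
    also have "\<dots> = (\<integral>\<^sup>+p. (\<Sum>a\<in>L. \<Sum>b\<in>L. ennreal (w a b) * indicator ((A \<inter> E a) \<times> (B \<inter> E b)) p) \<partial>(M \<Otimes>\<^sub>M M))"
      unfolding f_def sum_distrib_right
      by (intro nn_integral_cong sum.cong refl) (auto simp: indicator_def)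
    also have "\<dots> = (\<Sum>a\<in>L. \<Sum>b\<in>L. ennreal (w a b) * emeasure (M \<Otimes>\<^sub>M M) ((A \<inter> E a) \<times> (B \<inter> E b)))"
      using A B mE by (simp add: nn_integral_sum nn_integral_cmult_indicator)
    also have "\<dots> = (\<Sum>a\<in>L. \<Sum>b\<in>L. ennreal (w a b * (prob (A \<inter> E a) * prob (B \<inter> E b))))"
      using A B mE w
      by (intro sum.cong refl) (simp add: emeasure_pair_measure_Times emeasure_eq_measure ennreal_mult)
    also have "\<dots> = ennreal (\<Sum>a\<in>L. \<Sum>b\<in>L. w a b * (prob (A \<inter> E a) * prob (B \<inter> E b)))"
      using w by (simp add: sum_nonneg)
    finally show ?thesis .
  qed
  then show "measure \<sigma> (A \<times> B) = (\<Sum>a\<in>L. \<Sum>b\<in>L. w a b * (prob (A \<inter> E a) * prob (B \<inter> E b)))"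
    if "A \<in> sets M" "B \<in> sets M" for A B
    using that w by (simp add: measure_def sum_nonneg)
  have sub: "space M \<inter> E a = E a" if "a \<in> L" for a using sets.sets_into_space[OF mE[OF that]] by auto
  have fst: "emeasure \<sigma> (A \<times> space M) = emeasure M A" if A: "A \<in> sets M" for A
  proof -
    have "(\<Sum>a\<in>L. \<Sum>b\<in>L. w a b * (prob (A \<inter> E a) * prob (space M \<inter> E b)))
        = (\<Sum>a\<in>L. prob (A \<inter> E a) * (\<Sum>b\<in>L. w a b * prob (E b)))"
      by (simp add: sub sum_distrib_left mult_ac)
    also have "\<dots> = prob A" using sum_measure_partition[OF E A] by (simp add: row)
    finally show ?thesis using em[OF A sets.top] by (simp add: emeasure_eq_measure)
  qed
  have snd: "emeasure \<sigma> (space M \<times> B) = emeasure M B" if B: "B \<in> sets M" for B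
  proof -
    have "(\<Sum>a\<in>L. \<Sum>b\<in>L. w a b * (prob (space M \<inter> E a) * prob (B \<inter> E b)))
        = (\<Sum>b\<in>L. prob (B \<inter> E b) * (\<Sum>a\<in>L. w a b * prob (E a)))"
      by (subst sum.swap) (simp add: sub sum_distrib_left mult_ac)
    also have "\<dots> = prob B" using sum_measure_partition[OF E B] by (simp add: col)
    finally show ?thesis using em[OF sets.top B] by (simp add: emeasure_eq_measure)
  qed
  have sets: "sets \<sigma> = sets (M \<Otimes>\<^sub>M M)" and space: "space \<sigma> = space M \<times> space M"
    by (simp_all add: \<sigma>_def space_pair_measure)
  note [measurable_cong] = sets
  have "distr \<sigma> M fst = M"
  proof (rule measure_eqI)
    fix A assume "A \<in> sets (distr \<sigma> M fst)"
    then have A: "A \<in> sets M" by simp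
    have "fst -` A \<inter> space \<sigma> = A \<times> space M" using sets.sets_into_space[OF A] by (auto simp: space)
    then show "emeasure (distr \<sigma> M fst) A = emeasure M A"
      using A by (simp add: emeasure_distr fst)
  qed simp
  moreover have "distr \<sigma> M snd = M"
  proof (rule measure_eqI)
    fix A assume "A \<in> sets (distr \<sigma> M snd)"
    then have A: "A \<in> sets M" by simp
    have "snd -` A \<inter> space \<sigma> = space M \<times> A" using sets.sets_into_space[OF A] by (auto simp: space)
    then show "emeasure (distr \<sigma> M snd) A = emeasure M A"
      using A by (simp add: emeasure_distr snd)
  qed simp
  moreover have "prob_space \<sigma>"
    by (rule prob_spaceI) (use fst[OF sets.top] in \<open>simp add: space emeasure_space_1\<close>)
  ultimately show "\<sigma> \<in> C2 M" using sets by (simp add: C2_def)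
qed

text \<open>An almost doubly stochastic matrix is made exact by adding the defects of its row and column
  sums; adding the constant \<open>3 * \<epsilon>\<close> first and normalising keeps it nonnegative.\<close>

lemma coupling_of_almost_block_matrix:
  assumes E: "measurable_partition M L E" and p: "\<And>a b. a \<in> L \<Longrightarrow> b \<in> L \<Longrightarrow> 0 \<le> p a b \<and> p a b \<le> P"
    and row: "\<And>a. a \<in> L \<Longrightarrow> \<bar>(\<Sum>b\<in>L. p a b * prob (E b)) - 1\<bar> \<le> \<epsilon>"
    and col: "\<And>b. b \<in> L \<Longrightarrow> \<bar>(\<Sum>a\<in>L. p a b * prob (E a)) - 1\<bar> \<le> \<epsilon>"
    and \<epsilon>: "0 \<le> \<epsilon>"
  obtains \<sigma> where "\<sigma> \<in> C2 M"
    "\<And>A B. A \<in> sets M \<Longrightarrow> B \<in> sets M \<Longrightarrow>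
      \<bar>measure \<sigma> (A \<times> B) - (\<Sum>a\<in>L. \<Sum>b\<in>L. p a b * (prob (A \<inter> E a) * prob (B \<inter> E b)))\<bar> \<le> 3 * \<epsilon> * (2 + P)"
proof -
  define m where "m a = prob (E a)" for a
  define r where "r a = (\<Sum>b\<in>L. p a b * m b)" for a
  define c where "c b = (\<Sum>a\<in>L. p a b * m a)" for b
  define t where "t = (\<Sum>a\<in>L. r a * m a)"
  \<comment> \<open>Adding the row defect and the column defect corrects the total mass twice, so
    the total defect \<open>1 - t\<close> is subtracted once. Each of the three terms is at most
    \<epsilon> in absolute value, whence the constant \<open>3 * \<epsilon>\<close> that secures
    nonnegativity and the normalising factor \<open>1 + 3 * \<epsilon>\<close>.\<close>
  define w where "w a b = (p a b + 3 * \<epsilon> + ((1 - r a) + (1 - c b) - (1 - t))) / (1 + 3 * \<epsilon>)" for a b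
  have m0: "0 \<le> m a" for a by (simp add: m_def)
  have mE: "\<And>a. a \<in> L \<Longrightarrow> E a \<in> sets M" using E by (auto simp: measurable_partition_def)
  have sub: "space M \<inter> E a = E a" if "a \<in> L" for a using sets.sets_into_space[OF mE[OF that]] by auto
  have m1: "(\<Sum>a\<in>L. m a) = 1"
    using sum_measure_partition[OF E sets.top] by (simp add: sub prob_space m_def)
  have t': "t = (\<Sum>b\<in>L. c b * m b)"
    unfolding t_def r_def c_def sum_distrib_right by (subst sum.swap) (simp add: mult_ac)
  have r: "\<bar>r a - 1\<bar> \<le> \<epsilon>" if "a \<in> L" for a using row[OF that] by (simp add: r_def m_def)
  have c: "\<bar>c a - 1\<bar> \<le> \<epsilon>" if "a \<in> L" for a using col[OF that] by (simp add: c_def m_def)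
  have t: "\<bar>t - 1\<bar> \<le> \<epsilon>"
  proof -
    have "t - 1 = (\<Sum>a\<in>L. (r a - 1) * m a)" by (simp add: t_def left_diff_distrib sum_subtractf m1)
    then have "\<bar>t - 1\<bar> \<le> (\<Sum>a\<in>L. \<bar>r a - 1\<bar> * m a)"
      using sum_abs[of "\<lambda>a. (r a - 1) * m a" L] by (simp add: abs_mult m0)
    also have "\<dots> \<le> (\<Sum>a\<in>L. \<epsilon> * m a)" by (intro sum_mono mult_right_mono r m0)
    finally show ?thesis by (simp add: sum_distrib_left[symmetric] m1)
  qed
  have w0: "0 \<le> w a b" if "a \<in> L" "b \<in> L" for a b
    unfolding w_def using p[OF that] r[OF that(1)] c[OF that(2)] t \<epsilon>
    by (intro divide_nonneg_nonneg) linarith+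
  have wp: "\<bar>w a b - p a b\<bar> \<le> 3 * \<epsilon> * (2 + P)" if "a \<in> L" "b \<in> L" for a b
  proof -
    have "w a b - p a b = (3 * \<epsilon> + ((1 - r a) + (1 - c b) - (1 - t)) - 3 * \<epsilon> * p a b) / (1 + 3 * \<epsilon>)"
      using \<epsilon> by (simp add: w_def field_simps)
    also have "\<bar>\<dots>\<bar> \<le> \<bar>3 * \<epsilon> + ((1 - r a) + (1 - c b) - (1 - t)) - 3 * \<epsilon> * p a b\<bar>"
      using \<epsilon> unfolding abs_divide by (intro mult_imp_div_pos_le) (auto simp: algebra_simps)
    also have "\<dots> \<le> 6 * \<epsilon> + 3 * \<epsilon> * p a b"
    proof -
      have "0 \<le> 3 * \<epsilon> * p a b" using p[OF that] \<epsilon> by simp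
      then show ?thesis using r[OF that(1)] c[OF that(2)] t \<epsilon> by linarith
    qed
    also have "\<dots> \<le> 6 * \<epsilon> + 3 * \<epsilon> * P" using p[OF that] \<epsilon> by (simp add: mult_left_mono)
    finally show ?thesis by (simp add: algebra_simps)
  qed
  have rows: "(\<Sum>b\<in>L. w a b * m b) = 1" for a
  proof -
    have "(\<Sum>b\<in>L. w a b * m b) = (\<Sum>b\<in>L. p a b * m b + (3 * \<epsilon> + (1 - r a) + t) * m b - c b * m b) / (1 + 3 * \<epsilon>)"
      unfolding sum_divide_distrib w_def by (intro sum.cong refl) (simp add: algebra_simps)
    also have "(\<Sum>b\<in>L. p a b * m b + (3 * \<epsilon> + (1 - r a) + t) * m b - c b * m b) = 1 + 3 * \<epsilon>"
      by (simp add: sum.distrib sum_subtractf sum_distrib_left[symmetric] m1 r_def[symmetric] t'[symmetric])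
    finally show ?thesis using \<epsilon> by simp
  qed
  have cols: "(\<Sum>a\<in>L. w a b * m a) = 1" for b
  proof -
    have "(\<Sum>a\<in>L. w a b * m a) = (\<Sum>a\<in>L. p a b * m a + (3 * \<epsilon> + (1 - c b) + t) * m a - r a * m a) / (1 + 3 * \<epsilon>)"
      unfolding sum_divide_distrib w_def by (intro sum.cong refl) (simp add: algebra_simps)
    also have "(\<Sum>a\<in>L. p a b * m a + (3 * \<epsilon> + (1 - c b) + t) * m a - r a * m a) = 1 + 3 * \<epsilon>"
      by (simp add: sum.distrib sum_subtractf sum_distrib_left[symmetric] m1 c_def[symmetric] t_def[symmetric])
    finally show ?thesis using \<epsilon> by simp
  qed
  obtain \<sigma> where \<sigma>: "\<sigma> \<in> C2 M"
    "\<And>A B. A \<in> sets M \<Longrightarrow> B \<in> sets M \<Longrightarrow>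
      measure \<sigma> (A \<times> B) = (\<Sum>a\<in>L. \<Sum>b\<in>L. w a b * (prob (A \<inter> E a) * prob (B \<inter> E b)))"
    using coupling_of_block_matrix[OF E, of w, OF w0 rows[unfolded m_def] cols[unfolded m_def]] by blast
  show ?thesis
  proof (rule that[OF \<sigma>(1)])
    fix A B assume A: "A \<in> sets M" and B: "B \<in> sets M"
    let ?e = "3 * \<epsilon> * (2 + P)"
    have "measure \<sigma> (A \<times> B) - (\<Sum>a\<in>L. \<Sum>b\<in>L. p a b * (prob (A \<inter> E a) * prob (B \<inter> E b)))
        = (\<Sum>a\<in>L. \<Sum>b\<in>L. (w a b - p a b) * (prob (A \<inter> E a) * prob (B \<inter> E b)))"
      by (simp add: \<sigma>(2)[OF A B] left_diff_distrib sum_subtractf)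
    also have "\<bar>\<dots>\<bar> \<le> (\<Sum>a\<in>L. \<Sum>b\<in>L. \<bar>w a b - p a b\<bar> * (prob (A \<inter> E a) * prob (B \<inter> E b)))"
      by (intro order_trans[OF sum_abs] sum_mono) (simp add: abs_mult)
    also have "\<dots> \<le> (\<Sum>a\<in>L. \<Sum>b\<in>L. ?e * (prob (A \<inter> E a) * prob (B \<inter> E b)))"
      by (intro sum_mono mult_right_mono wp) auto
    also have "\<dots> = ?e * (prob A * prob B)"
      unfolding sum_measure_partition[OF E A, symmetric] sum_measure_partition[OF E B, symmetric] sum_product
      by (simp only: sum_distrib_left)
    also have "\<dots> \<le> ?e"
    \<comment> \<open>Nonnegativity of \<open>P\<close> follows only from the presence of an entry
      of \<open>p\<close>; an empty \<open>L\<close> contradicts total mass 1.\<close>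
    proof (cases "L = {}")
      case True
      then show ?thesis using m1 by simp
    next
      case False
      then have "0 \<le> P" using p by force
      moreover have "prob A * prob B \<le> 1" by (simp add: mult_le_one)
      ultimately show ?thesis using \<epsilon> by (intro mult_left_le) auto
    qed
    finally show "\<bar>measure \<sigma> (A \<times> B) - (\<Sum>a\<in>L. \<Sum>b\<in>L. p a b * (prob (A \<inter> E a) * prob (B \<inter> E b)))\<bar> \<le> ?e" .
  qed
qed

text \<open>\<open>h\<close> is the average density of \<rho> on each product block relative to the
  product measure. The marginal conditions on \<rho> become the statement that its weighted row and
  column sums are 1.\<close>

lemma exists_block_density:
  assumes E: "measurable_partition M I E" and \<rho>: "\<rho> \<in> C2 M"
  obtains h :: "'i \<Rightarrow> 'i \<Rightarrow> real" where
    "\<And>i j. 0 \<le> h i j"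
    "\<And>i j. i \<in> I \<Longrightarrow> j \<in> I \<Longrightarrow> h i j * (prob (E i) * prob (E j)) = measure \<rho> (E i \<times> E j)"
    "\<And>i. i \<in> I \<Longrightarrow> (\<Sum>j\<in>I. h i j * prob (E j)) = 1"
    "\<And>j. j \<in> I \<Longrightarrow> (\<Sum>i\<in>I. h i j * prob (E i)) = 1"
proof
  interpret R: prob_space \<rho> by (rule C2D[OF \<rho>])
  note [measurable_cong] = C2D(1)[OF \<rho>]
  \<comment> \<open>On null blocks the default 1 keeps the row and column sums equal to 1. The mass
    identity survives there because \<rho> of a rectangle is at most the measure of either
    side.\<close>
  define h where "h i j = (if prob (E i) * prob (E j) = 0 then 1
    else measure \<rho> (E i \<times> E j) / (prob (E i) * prob (E j)))" for i j
  have mE: "\<And>a. a \<in> I \<Longrightarrow> E a \<in> sets M" using E by (auto simp: measurable_partition_def)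
  have sub: "space M \<inter> E a = E a" if "a \<in> I" for a using sets.sets_into_space[OF mE[OF that]] by auto
  have sum1: "(\<Sum>a\<in>I. prob (E a)) = 1"
    using sum_measure_partition[OF E sets.top] by (simp add: sub prob_space)
  have fst: "measure \<rho> (A \<times> space M) = prob A" if "A \<in> sets M" for A
  proof -
    have "prob A = measure (distr \<rho> M fst) A" by (simp add: C2D(3)[OF \<rho>])
    also have "\<dots> = measure \<rho> (fst -` A \<inter> space \<rho>)" using that by (intro measure_distr) auto
    also have "fst -` A \<inter> space \<rho> = A \<times> space M"
      using sets.sets_into_space[OF that] by (auto simp: C2D(5)[OF \<rho>])
    finally show ?thesis by simp
  qed
  have snd: "measure \<rho> (space M \<times> A) = prob A" if "A \<in> sets M" for A
  proof -
    have "prob A = measure (distr \<rho> M snd) A" by (simp add: C2D(4)[OF \<rho>])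
    also have "\<dots> = measure \<rho> (snd -` A \<inter> space \<rho>)" using that by (intro measure_distr) auto
    also have "snd -` A \<inter> space \<rho> = space M \<times> A"
      using sets.sets_into_space[OF that] by (auto simp: C2D(5)[OF \<rho>])
    finally show ?thesis by simp
  qed
  have le: "measure \<rho> (A \<times> B) \<le> prob A" "measure \<rho> (A \<times> B) \<le> prob B" if "A \<in> sets M" "B \<in> sets M" for A B
    using that sets.sets_into_space[of A M] sets.sets_into_space[of B M] C2D(1)[OF \<rho>]
      R.finite_measure_mono[of "A \<times> B" "A \<times> space M"] R.finite_measure_mono[of "A \<times> B" "space M \<times> B"]
    by (auto simp: fst snd)
  have rowI: "(\<Sum>j\<in>I. measure \<rho> (E i \<times> E j)) = prob (E i)" if i: "i \<in> I" for i
  proof -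
    have "measurable_partition \<rho> I (\<lambda>j. space M \<times> E j)"
      using E unfolding measurable_partition_def C2D(5)[OF \<rho>] C2D(1)[OF \<rho>]
      by (auto simp: disjoint_family_on_def)
    from R.sum_measure_partition[OF this, of "E i \<times> space M"] show ?thesis
      using i mE sub sub[unfolded Int_commute[of "space M"]] C2D(1)[OF \<rho>] by (simp add: Times_Int_Times fst)
  qed
  have colI: "(\<Sum>i\<in>I. measure \<rho> (E i \<times> E j)) = prob (E j)" if j: "j \<in> I" for j
  proof -
    have "measurable_partition \<rho> I (\<lambda>j. E j \<times> space M)"
      using E unfolding measurable_partition_def C2D(5)[OF \<rho>] C2D(1)[OF \<rho>]
      by (auto simp: disjoint_family_on_def)
    from R.sum_measure_partition[OF this, of "space M \<times> E j"] show ?thesis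
      using j mE sub sub[unfolded Int_commute[of "space M"]] C2D(1)[OF \<rho>] by (simp add: Times_Int_Times snd)
  qed
  show "0 \<le> h i j" for i j by (simp add: h_def)
  show hm: "h i j * (prob (E i) * prob (E j)) = measure \<rho> (E i \<times> E j)" if "i \<in> I" "j \<in> I" for i j
    using le[OF mE[OF that(1)] mE[OF that(2)]] measure_nonneg[of \<rho> "E i \<times> E j"] by (auto simp: h_def intro: order_antisym)
  show "(\<Sum>j\<in>I. h i j * prob (E j)) = 1" if i: "i \<in> I" for i
  proof (cases "prob (E i) = 0")
    case True
    then show ?thesis by (simp add: h_def sum1)
  next
    case False
    have "prob (E i) * (\<Sum>j\<in>I. h i j * prob (E j)) = (\<Sum>j\<in>I. h i j * (prob (E i) * prob (E j)))"
      by (simp add: sum_distrib_left mult_ac)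
    also have "\<dots> = prob (E i)" using hm[OF i] rowI[OF i] by simp
    finally show ?thesis using False by simp
  qed
  show "(\<Sum>i\<in>I. h i j * prob (E i)) = 1" if j: "j \<in> I" for j
  proof (cases "prob (E j) = 0")
    case True
    then show ?thesis by (simp add: h_def sum1)
  next
    case False
    have "prob (E j) * (\<Sum>i\<in>I. h i j * prob (E i)) = (\<Sum>i\<in>I. h i j * (prob (E i) * prob (E j)))"
      by (simp add: sum_distrib_left mult_ac)
    also have "\<dots> = prob (E j)" using hm[OF _ j] colI[OF j] by simp
    finally show ?thesis using False by simp
  qed
qed

end

section \<open>Weak mixing implies topological weak mixing of the lens\<close>

text \<open>The induction follows the generation of the topology: intersections merge the test
  families and take the smaller tolerance. One family supplies both sides of the test rectangles, so
  a single partition can later refine all of them.\<close>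

lemma openin_C2_neighbourhood:
  assumes "openin (C2_topology M) U" "\<rho> \<in> U"
  obtains \<A> \<epsilon> where "finite \<A>" "\<A> \<subseteq> sets M" "0 < \<epsilon>"
    "\<And>\<sigma>. \<sigma> \<in> C2 M \<Longrightarrow> (\<And>A B. A \<in> \<A> \<Longrightarrow> B \<in> \<A> \<Longrightarrow> \<bar>measure \<sigma> (A \<times> B) - measure \<rho> (A \<times> B)\<bar> < \<epsilon>) \<Longrightarrow> \<sigma> \<in> U"
proof -
  define near where "near \<A> \<epsilon> \<sigma> \<longleftrightarrow> (\<forall>A\<in>\<A>. \<forall>B\<in>\<A>. \<bar>measure \<sigma> (A \<times> B) - measure \<rho> (A \<times> B)\<bar> < \<epsilon>)"
    for \<A> :: "'a set set" and \<epsilon> and \<sigma> :: "('a \<times> 'a) measure"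
  have "generate_topology_on
     {{\<rho>\<in>C2 M. measure \<rho> (A \<times> B) \<in> U} | A B U. A \<in> sets M \<and> B \<in> sets M \<and> open U} U"
    using assms(1) unfolding C2_topology_def by (rule openin_topology_generated_by)
  then have "\<exists>\<A> \<epsilon>. finite \<A> \<and> \<A> \<subseteq> sets M \<and> 0 < \<epsilon> \<and> (\<forall>\<sigma>\<in>C2 M. near \<A> \<epsilon> \<sigma> \<longrightarrow> \<sigma> \<in> U)"
    using assms(2)
  proof induction
    case Empty
    then show ?case by simp
  next
    case (Int U V)
    then obtain \<A> \<epsilon> \<B> \<delta> where
      "finite \<A>" "\<A> \<subseteq> sets M" "0 < \<epsilon>" and U: "\<forall>\<sigma>\<in>C2 M. near \<A> \<epsilon> \<sigma> \<longrightarrow> \<sigma> \<in> U"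
      and "finite \<B>" "\<B> \<subseteq> sets M" "0 < \<delta>" and V: "\<forall>\<sigma>\<in>C2 M. near \<B> \<delta> \<sigma> \<longrightarrow> \<sigma> \<in> V"
      by auto
    moreover have "near \<A> \<epsilon> \<sigma> \<and> near \<B> \<delta> \<sigma>" if "near (\<A> \<union> \<B>) (min \<epsilon> \<delta>) \<sigma>" for \<sigma>
      using that by (auto simp: near_def)
    ultimately show ?case
      by (intro exI[of _ "\<A> \<union> \<B>"] exI[of _ "min \<epsilon> \<delta>"]) auto
  next
    case (UN K)
    then obtain k where k: "k \<in> K" "\<rho> \<in> k" by auto
    from UN(2)[OF this] show ?case using k(1) by (meson UnionI)
  next
    case (Basis W)
    then obtain A B S where W: "W = {\<rho>\<in>C2 M. measure \<rho> (A \<times> B) \<in> S}"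
      and AB: "A \<in> sets M" "B \<in> sets M" and "open S" by auto
    with Basis obtain \<epsilon> where "0 < \<epsilon>" and \<epsilon>: "\<And>y. dist y (measure \<rho> (A \<times> B)) < \<epsilon> \<Longrightarrow> y \<in> S"
      unfolding open_dist by blast
    moreover have "\<forall>\<sigma>\<in>C2 M. near {A, B} \<epsilon> \<sigma> \<longrightarrow> \<sigma> \<in> W"
      using \<epsilon> by (auto simp: near_def W dist_real_def)
    ultimately show ?case using AB by (intro exI[of _ "{A, B}"] exI[of _ \<epsilon>]) simp
  qed
  then obtain \<A> \<epsilon> where A: "finite \<A>" "\<A> \<subseteq> sets M" "0 < \<epsilon>" and near: "\<forall>\<sigma>\<in>C2 M. near \<A> \<epsilon> \<sigma> \<longrightarrow> \<sigma> \<in> U"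
    by auto
  show ?thesis
  proof (rule that[OF A])
    fix \<sigma> assume "\<sigma> \<in> C2 M"
      and "\<And>A B. A \<in> \<A> \<Longrightarrow> B \<in> \<A> \<Longrightarrow> \<bar>measure \<sigma> (A \<times> B) - measure \<rho> (A \<times> B)\<bar> < \<epsilon>"
    with near show "\<sigma> \<in> U" unfolding near_def by simp
  qed
qed

text \<open>Separation of variables for weights in which one factor sees the first components of the
  indices and the other the second components.\<close>

lemma sum_product_blocks:
  fixes F G :: "'i \<Rightarrow> 'i \<Rightarrow> real"
  shows "(\<Sum>a\<in>I\<times>I. \<Sum>b\<in>I\<times>I. F (fst a) (fst b) * G (snd a) (snd b)) = (\<Sum>i\<in>I. \<Sum>j\<in>I. F i j) * (\<Sum>i\<in>I. \<Sum>j\<in>I. G i j)"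
proof -
  have "(\<Sum>a\<in>I\<times>I. \<Sum>b\<in>I\<times>I. F (fst a) (fst b) * G (snd a) (snd b))
      = (\<Sum>i\<in>I. \<Sum>i'\<in>I. (\<Sum>j\<in>I. \<Sum>j'\<in>I. F i j * G i' j'))"
    by (simp add: sum.cartesian_product')
  also have "\<dots> = (\<Sum>i\<in>I. \<Sum>i'\<in>I. (\<Sum>j\<in>I. F i j) * (\<Sum>j\<in>I. G i' j))"
    by (simp add: sum_product)
  finally show ?thesis by (simp add: sum_product)
qed

text \<open>The difference of products is split as
  \<open>(m a - q a) * m b + q a * (m b - q b)\<close>. As \<open>m\<close> and \<open>q\<close>
  have total mass 1, each part contributes at most \<open>P\<close> times the l1 distance of the
  weights.\<close>

lemma product_weights_error:
  fixes m q :: "'l \<Rightarrow> real"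
  assumes p: "\<And>a b. a \<in> L \<Longrightarrow> b \<in> L \<Longrightarrow> \<bar>p a b\<bar> \<le> P"
    and m: "\<And>a. 0 \<le> m a" "sum m L = 1" and q: "\<And>a. 0 \<le> q a" "sum q L = 1"
  shows "\<bar>(\<Sum>a\<in>L. \<Sum>b\<in>L. p a b * (m a * m b)) - (\<Sum>a\<in>L. \<Sum>b\<in>L. p a b * (q a * q b))\<bar>
    \<le> 2 * P * (\<Sum>a\<in>L. \<bar>m a - q a\<bar>)"
proof -
  have "(\<Sum>a\<in>L. \<Sum>b\<in>L. p a b * (m a * m b)) - (\<Sum>a\<in>L. \<Sum>b\<in>L. p a b * (q a * q b))
      = (\<Sum>a\<in>L. \<Sum>b\<in>L. p a b * ((m a - q a) * m b + q a * (m b - q b)))"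
    by (simp add: sum_subtractf[symmetric] algebra_simps)
  also have "\<bar>\<dots>\<bar> \<le> (\<Sum>a\<in>L. \<Sum>b\<in>L. P * (\<bar>m a - q a\<bar> * m b + q a * \<bar>m b - q b\<bar>))"
  proof (intro order_trans[OF sum_abs] sum_mono)
    fix a b assume ab: "a \<in> L" "b \<in> L"
    have "\<bar>(m a - q a) * m b + q a * (m b - q b)\<bar> \<le> \<bar>m a - q a\<bar> * m b + q a * \<bar>m b - q b\<bar>"
      using abs_triangle_ineq[of "(m a - q a) * m b" "q a * (m b - q b)"] m(1)[of b] q(1)[of a] by (simp add: abs_mult)
    then show "\<bar>p a b * ((m a - q a) * m b + q a * (m b - q b))\<bar> \<le> P * (\<bar>m a - q a\<bar> * m b + q a * \<bar>m b - q b\<bar>)"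
      unfolding abs_mult[of "p a b"] using p[OF ab] by (intro mult_mono) auto
  qed
  also have "\<dots> = P * ((\<Sum>a\<in>L. \<bar>m a - q a\<bar>) * sum m L + sum q L * (\<Sum>b\<in>L. \<bar>m b - q b\<bar>))"
    by (simp only: sum_distrib_left[symmetric] sum.distrib sum_product)
  finally show ?thesis using m(2) q(2) by simp
qed

section \<open>Simultaneous control of a self-coupling and of its image under the lens\<close>

context measure_preserving_system
begin

text \<open>This is the l1 distance between the joint law of the blocks visited at times 0 and
  \<open>n\<close> and the product of the two laws.\<close>

definition mixing_defect :: "'i set \<Rightarrow> ('i \<Rightarrow> 'a set) \<Rightarrow> nat \<Rightarrow> real" where
  "mixing_defect I E n = (\<Sum>a\<in>I\<times>I. \<bar>prob ((T ^^ n) -` E (snd a) \<inter> E (fst a)) - prob (E (snd a)) * prob (E (fst a))\<bar>)"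

lemma mixing_defect_nonneg: "0 \<le> mixing_defect I E n"
  by (simp add: mixing_defect_def sum_nonneg)

text \<open>The defect is a finite sum of sequences whose averages tend to 0. A positive lower bound
  on all its values would persist in the averages.\<close>

lemma weakly_mixing_small_defect:
  assumes wm: "weakly_mixing M T" and E: "measurable_partition M I E" and e: "0 < e"
  obtains n where "mixing_defect I E n < e"
proof (rule ccontr)
  assume "\<not> thesis"
  then have ge: "e \<le> mixing_defect I E n" for n using that by (meson not_le)
  have "(\<lambda>n. \<Sum>a\<in>I\<times>I. (\<Sum>k<n. \<bar>prob ((T ^^ k) -` E (snd a) \<inter> E (fst a)) - prob (E (snd a)) * prob (E (fst a))\<bar>) / real n)
      \<longlonglongrightarrow> (\<Sum>a\<in>I\<times>I. 0)"
    using wm E unfolding weakly_mixing_def measurable_partition_def by (intro tendsto_sum) auto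
  moreover have "(\<Sum>a\<in>I\<times>I. (\<Sum>k<n. \<bar>prob ((T ^^ k) -` E (snd a) \<inter> E (fst a)) - prob (E (snd a)) * prob (E (fst a))\<bar>) / real n)
      = (\<Sum>k<n. mixing_defect I E k) / real n" for n
    unfolding mixing_defect_def sum_divide_distrib by (rule sum.swap)
  ultimately have "(\<lambda>n. (\<Sum>k<n. mixing_defect I E k) / real n) \<longlonglongrightarrow> 0" by simp
  then have "e \<le> 0"
  proof (rule LIMSEQ_le_const, intro exI allI impI)
    fix n :: nat assume "1 \<le> n"
    moreover have "real n * e \<le> (\<Sum>k<n. mixing_defect I E k)"
      using sum_mono[of "{..<n}" "\<lambda>_. e", OF ge] by simp
    ultimately show "e \<le> (\<Sum>k<n. mixing_defect I E k) / real n" by (simp add: field_simps)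
  qed
  with e show False by simp
qed

lemma partition_refine:
  assumes E: "measurable_partition M I E"
  shows "measurable_partition M (I \<times> I) (\<lambda>a. (T ^^ n) -` E (snd a) \<inter> E (fst a))"
  unfolding measurable_partition_def
proof (intro conjI ballI)
  have disj: "E i \<inter> E j = {}" if "i \<in> I" "j \<in> I" "i \<noteq> j" for i j
    using E that unfolding measurable_partition_def disjoint_family_on_def by blast
  have mE: "E i \<in> sets M" if "i \<in> I" for i using E that by (auto simp: measurable_partition_def)
  have un: "(\<Union>i\<in>I. E i) = space M" using E by (simp add: measurable_partition_def)
  show "finite (I \<times> I)" using E by (simp add: measurable_partition_def)
  show "(T ^^ n) -` E (snd a) \<inter> E (fst a) \<in> sets M" if "a \<in> I \<times> I" for a
    using that by (intro vimage_funpow_Int_measurable mE) auto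
  show "disjoint_family_on (\<lambda>a. (T ^^ n) -` E (snd a) \<inter> E (fst a)) (I \<times> I)"
    unfolding disjoint_family_on_def
  proof (intro ballI impI)
    fix a b assume "a \<in> I \<times> I" "b \<in> I \<times> I" "a \<noteq> b"
    then have "E (fst a) \<inter> E (fst b) = {} \<or> E (snd a) \<inter> E (snd b) = {}"
      using disj by (metis mem_Times_iff prod.expand)
    then show "((T ^^ n) -` E (snd a) \<inter> E (fst a)) \<inter> ((T ^^ n) -` E (snd b) \<inter> E (fst b)) = {}"
      by auto
  qed
  show "(\<Union>a\<in>I \<times> I. (T ^^ n) -` E (snd a) \<inter> E (fst a)) = space M"
  proof (intro equalityI subsetI)
    fix x assume x: "x \<in> space M"
    then have "(T ^^ n) x \<in> space M" using measurable_space[OF funpow_measurable] by blast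
    with x un obtain i j where "i \<in> I" "x \<in> E i" "j \<in> I" "(T ^^ n) x \<in> E j" by blast
    then show "x \<in> (\<Union>a\<in>I \<times> I. (T ^^ n) -` E (snd a) \<inter> E (fst a))"
      by (intro UN_I[of "(i, j)"]) auto
  qed (use un in auto)
qed

text \<open>If the partition and its preimage under \<open>T ^^ n\<close> were independent, the block density
  \<open>h * (g \<circ> (T \<times> T) ^^ n)\<close> would be a self-coupling that agrees with \<^term>\<open>\<eta>\<close> on the blocks and
  whose image under the \<open>n\<close>-th power of the lens agrees with \<^term>\<open>\<rho>\<close>.\<close>

lemma lens_joint_approximation:
  assumes E: "measurable_partition M I E"
    and ref: "\<And>A i. A \<in> \<A> \<Longrightarrow> i \<in> I \<Longrightarrow> E i \<subseteq> A \<or> A \<inter> E i = {}" and \<A>: "\<A> \<subseteq> sets M"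
    and \<eta>: "\<eta> \<in> C2 M" and \<rho>: "\<rho> \<in> C2 M"
  obtains C where "0 \<le> C" "\<And>n. \<exists>\<sigma>\<in>C2 M. \<forall>A\<in>\<A>. \<forall>B\<in>\<A>.
      \<bar>measure \<sigma> (A \<times> B) - measure \<eta> (A \<times> B)\<bar> \<le> C * mixing_defect I E n
    \<and> \<bar>measure ((lens M T ^^ n) \<sigma>) (A \<times> B) - measure \<rho> (A \<times> B)\<bar> \<le> C * mixing_defect I E n"
proof -
  obtain h where h: "\<And>i j. 0 \<le> h i j"
    "\<And>i j. i \<in> I \<Longrightarrow> j \<in> I \<Longrightarrow> h i j * (prob (E i) * prob (E j)) = measure \<eta> (E i \<times> E j)"
    "\<And>i. i \<in> I \<Longrightarrow> (\<Sum>j\<in>I. h i j * prob (E j)) = 1"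
    "\<And>j. j \<in> I \<Longrightarrow> (\<Sum>i\<in>I. h i j * prob (E i)) = 1"
    using exists_block_density[OF E \<eta>] by blast
  obtain g where g: "\<And>i j. 0 \<le> g i j"
    "\<And>i j. i \<in> I \<Longrightarrow> j \<in> I \<Longrightarrow> g i j * (prob (E i) * prob (E j)) = measure \<rho> (E i \<times> E j)"
    "\<And>i. i \<in> I \<Longrightarrow> (\<Sum>j\<in>I. g i j * prob (E j)) = 1"
    "\<And>j. j \<in> I \<Longrightarrow> (\<Sum>i\<in>I. g i j * prob (E i)) = 1"
    using exists_block_density[OF E \<rho>] by blast
  have fin: "finite I" and mE: "\<And>i. i \<in> I \<Longrightarrow> E i \<in> sets M" using E by (auto simp: measurable_partition_def)
  have sub: "space M \<inter> E i = E i" if "i \<in> I" for i using sets.sets_into_space[OF mE[OF that]] by auto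
  let ?L = "I \<times> I"
  define p where "p a b = h (fst a) (fst b) * g (snd a) (snd b)" for a b
  \<comment> \<open>A crude bound for the entries of \<open>p\<close>, independent of
    \<open>n\<close>; this makes the final constant uniform in time.\<close>
  define P where "P = (\<Sum>a\<in>?L. \<Sum>b\<in>?L. p a b)"
  have p0: "0 \<le> p a b" for a b by (simp add: p_def h(1) g(1))
  have pP: "p a b \<le> P" if "a \<in> ?L" "b \<in> ?L" for a b
  proof -
    have "p a b \<le> (\<Sum>b\<in>?L. p a b)" using that(2) p0 fin by (intro member_le_sum) auto
    also have "\<dots> \<le> P" unfolding P_def
      using that(1) p0 fin by (intro member_le_sum[where f="\<lambda>a. \<Sum>b\<in>?L. p a b"]) (auto intro: sum_nonneg)
    finally show ?thesis .
  qed
  have P0: "0 \<le> P" unfolding P_def by (intro sum_nonneg p0)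
  \<comment> \<open>These are the block masses that exact independence of times 0 and
    \<open>n\<close> would give. With respect to them the weighted row and column sums of
    \<open>p\<close> are exactly 1.\<close>
  define q where "q a = prob (E (snd a)) * prob (E (fst a))" for a
  have q0: "0 \<le> q a" for a by (simp add: q_def)
  have sum1: "(\<Sum>i\<in>I. prob (E i)) = 1"
    using sum_measure_partition[OF E sets.top] by (simp add: sub prob_space)
  have q1: "sum q ?L = 1"
  proof -
    have "sum q ?L = (\<Sum>i\<in>I. \<Sum>j\<in>I. prob (E j) * prob (E i))"
      by (simp add: q_def sum.cartesian_product case_prod_beta')
    also have "\<dots> = 1" by (simp add: sum_distrib_right[symmetric] sum_distrib_left[symmetric] sum1)
    finally show ?thesis .
  qed
  have rowq: "(\<Sum>b\<in>?L. p a b * q b) = 1" if "a \<in> ?L" for a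
  proof -
    have "(\<Sum>b\<in>?L. p a b * q b)
        = (\<Sum>j\<in>I. \<Sum>j'\<in>I. (h (fst a) j * prob (E j)) * (g (snd a) j' * prob (E j')))"
      by (simp add: p_def q_def sum.cartesian_product case_prod_beta' mult_ac)
    also have "\<dots> = (\<Sum>j\<in>I. h (fst a) j * prob (E j)) * (\<Sum>j\<in>I. g (snd a) j * prob (E j))"
      by (simp only: sum_product)
    finally show ?thesis using that h(3)[of "fst a"] g(3)[of "snd a"] by auto
  qed
  have colq: "(\<Sum>a\<in>?L. p a b * q a) = 1" if "b \<in> ?L" for b
  proof -
    have "(\<Sum>a\<in>?L. p a b * q a)
        = (\<Sum>j\<in>I. \<Sum>j'\<in>I. (h j (fst b) * prob (E j)) * (g j' (snd b) * prob (E j')))"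
      by (simp add: p_def q_def sum.cartesian_product case_prod_beta' mult_ac)
    also have "\<dots> = (\<Sum>j\<in>I. h j (fst b) * prob (E j)) * (\<Sum>j\<in>I. g j (snd b) * prob (E j))"
      by (simp only: sum_product)
    finally show ?thesis using that h(4)[of "fst b"] g(4)[of "snd b"] by auto
  qed
  \<comment> \<open>\<open>u A i\<close> records whether block \<open>i\<close> lies in
    \<open>A\<close>. Since the partition refines the test sets, \<open>A\<close> contains the block
    or is disjoint from it, and no other proportion occurs.\<close>
  define u where "u A i = (if E i \<subseteq> A then 1 else 0 :: real)" for A i
  have u: "0 \<le> u A i" "u A i \<le> 1" for A i by (simp_all add: u_def)
  have block_sum: "(\<Sum>i\<in>I. \<Sum>j\<in>I. u A i * u B j * measure \<tau> (E i \<times> E j)) = measure \<tau> (A \<times> B)"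
    if A: "A \<in> \<A>" and B: "B \<in> \<A>" and \<tau>: "\<tau> \<in> C2 M" for A B \<tau>
  proof -
    have "u A i * u B j * measure \<tau> (E i \<times> E j) = measure \<tau> ((A \<inter> E i) \<times> (B \<inter> E j))"
      if "i \<in> I" "j \<in> I" for i j
    proof -
      have "A \<inter> E i = (if E i \<subseteq> A then E i else {})" "B \<inter> E j = (if E j \<subseteq> B then E j else {})"
        using ref[OF A that(1)] ref[OF B that(2)] by auto
      then show ?thesis by (simp add: u_def)
    qed
    moreover have "A \<in> sets M" "B \<in> sets M" using A B \<A> by auto
    ultimately show ?thesis
      using sum_measure_C2_partition[OF E \<tau>, of A B] by simp
  qed
  have total: "(\<Sum>i\<in>I. \<Sum>j\<in>I. k i j * (prob (E i) * prob (E j))) = 1"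
    if "\<And>i. i \<in> I \<Longrightarrow> (\<Sum>j\<in>I. k i j * prob (E j)) = 1" for k
  proof -
    have "(\<Sum>i\<in>I. \<Sum>j\<in>I. k i j * (prob (E i) * prob (E j))) = (\<Sum>i\<in>I. prob (E i) * (\<Sum>j\<in>I. k i j * prob (E j)))"
      by (simp add: sum_distrib_left mult_ac)
    then show ?thesis using that sum1 by simp
  qed
  \<comment> \<open>Tests on the first components leave the factor with \<open>g\<close> untouched.
    It sums to 1, and the factor with \<open>h\<close> yields \<eta>; tests on the second components
    exchange the roles and yield \<rho>.\<close>
  have \<eta>_sum: "(\<Sum>a\<in>?L. \<Sum>b\<in>?L. (p a b * (u A (fst a) * u B (fst b))) * (q a * q b)) = measure \<eta> (A \<times> B)"
    if A: "A \<in> \<A>" and B: "B \<in> \<A>" for A B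
  proof -
    have "(\<Sum>a\<in>?L. \<Sum>b\<in>?L. (p a b * (u A (fst a) * u B (fst b))) * (q a * q b))
      = (\<Sum>a\<in>?L. \<Sum>b\<in>?L. (u A (fst a) * u B (fst b) * (h (fst a) (fst b) * (prob (E (fst a)) * prob (E (fst b)))))
          * (g (snd a) (snd b) * (prob (E (snd a)) * prob (E (snd b)))))"
      by (simp add: p_def q_def mult_ac)
    also have "\<dots> = (\<Sum>i\<in>I. \<Sum>j\<in>I. u A i * u B j * (h i j * (prob (E i) * prob (E j))))
        * (\<Sum>i\<in>I. \<Sum>j\<in>I. g i j * (prob (E i) * prob (E j)))"
      by (rule sum_product_blocks)
    also have "\<dots> = measure \<eta> (A \<times> B)"
      using total[of g, OF g(3)] block_sum[OF A B \<eta>] h(2) by simp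
    finally show ?thesis .
  qed
  have \<rho>_sum: "(\<Sum>a\<in>?L. \<Sum>b\<in>?L. (p a b * (u A (snd a) * u B (snd b))) * (q a * q b)) = measure \<rho> (A \<times> B)"
    if A: "A \<in> \<A>" and B: "B \<in> \<A>" for A B
  proof -
    have "(\<Sum>a\<in>?L. \<Sum>b\<in>?L. (p a b * (u A (snd a) * u B (snd b))) * (q a * q b))
      = (\<Sum>a\<in>?L. \<Sum>b\<in>?L. (h (fst a) (fst b) * (prob (E (fst a)) * prob (E (fst b))))
          * (u A (snd a) * u B (snd b) * (g (snd a) (snd b) * (prob (E (snd a)) * prob (E (snd b))))))"
      by (simp add: p_def q_def mult_ac)
    also have "\<dots> = (\<Sum>i\<in>I. \<Sum>j\<in>I. h i j * (prob (E i) * prob (E j)))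
        * (\<Sum>i\<in>I. \<Sum>j\<in>I. u A i * u B j * (g i j * (prob (E i) * prob (E j))))"
      by (rule sum_product_blocks)
    also have "\<dots> = measure \<rho> (A \<times> B)"
      using total[of h, OF h(3)] block_sum[OF A B \<rho>] g(2) by simp
    finally show ?thesis .
  qed
  show ?thesis
  \<comment> \<open>The first term is the cost of making the matrix exact with tolerance
    \<open>P * mixing_defect I E n\<close>, the second that of replacing the true block masses by
    the product masses \<open>q\<close>.\<close>
  proof (rule that[of "3 * P * (2 + P) + 2 * P"])
    show "0 \<le> 3 * P * (2 + P) + 2 * P" using P0 by simp
    fix n
    let ?D = "mixing_defect I E n"
    define E2 where "E2 a = (T ^^ n) -` E (snd a) \<inter> E (fst a)" for a
    have E2: "measurable_partition M ?L E2" unfolding E2_def by (rule partition_refine[OF E])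
    have mE2: "\<And>a. a \<in> ?L \<Longrightarrow> E2 a \<in> sets M" using E2 by (auto simp: measurable_partition_def)
    have sub2: "space M \<inter> E2 a = E2 a" if "a \<in> ?L" for a using sets.sets_into_space[OF mE2[OF that]] by auto
    have m1: "(\<Sum>a\<in>?L. prob (E2 a)) = 1"
      using sum_measure_partition[OF E2 sets.top] by (simp add: sub2 prob_space)
    have D: "?D = (\<Sum>a\<in>?L. \<bar>prob (E2 a) - q a\<bar>)" by (simp add: mixing_defect_def E2_def q_def)
    \<comment> \<open>Applied to the rows and columns of \<open>p\<close>, this turns the exact sums
      for \<open>q\<close> into almost exact sums for the true block masses.\<close>
    have weighted: "\<bar>(\<Sum>b\<in>?L. k b * prob (E2 b)) - (\<Sum>b\<in>?L. k b * q b)\<bar> \<le> P * ?D"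
      if k: "\<And>b. b \<in> ?L \<Longrightarrow> 0 \<le> k b \<and> k b \<le> P" for k
    proof -
      have "(\<Sum>b\<in>?L. k b * prob (E2 b)) - (\<Sum>b\<in>?L. k b * q b) = (\<Sum>b\<in>?L. k b * (prob (E2 b) - q b))"
        by (simp add: sum_subtractf right_diff_distrib)
      also have "\<bar>\<dots>\<bar> \<le> (\<Sum>b\<in>?L. P * \<bar>prob (E2 b) - q b\<bar>)"
      proof (intro order_trans[OF sum_abs] sum_mono)
        fix b assume "b \<in> ?L"
        then show "\<bar>k b * (prob (E2 b) - q b)\<bar> \<le> P * \<bar>prob (E2 b) - q b\<bar>"
          using k[of b] by (simp add: abs_mult mult_right_mono)
      qed
      finally show ?thesis by (simp add: D sum_distrib_left)
    qed
    have "\<bar>(\<Sum>b\<in>?L. p a b * prob (E2 b)) - 1\<bar> \<le> P * ?D" if "a \<in> ?L" for a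
      using weighted[of "p a"] p0 pP[OF that] by (simp add: rowq[OF that])
    moreover have "\<bar>(\<Sum>a\<in>?L. p a b * prob (E2 a)) - 1\<bar> \<le> P * ?D" if "b \<in> ?L" for b
      using weighted[of "\<lambda>a. p a b"] p0 pP[OF _ that] by (simp add: colq[OF that])
    moreover have "0 \<le> P * ?D" using P0 mixing_defect_nonneg[of I E n] by simp
    ultimately obtain \<sigma> where \<sigma>: "\<sigma> \<in> C2 M" and \<sigma>_eq: "\<And>A B. A \<in> sets M \<Longrightarrow> B \<in> sets M \<Longrightarrow>
      \<bar>measure \<sigma> (A \<times> B) - (\<Sum>a\<in>?L. \<Sum>b\<in>?L. p a b * (prob (A \<inter> E2 a) * prob (B \<inter> E2 b)))\<bar> \<le> 3 * (P * ?D) * (2 + P)"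
      using coupling_of_almost_block_matrix[OF E2, of p P "P * ?D"] p0 pP by blast
    \<comment> \<open>One estimate serves both conclusions: \<eta> is tested with sets at time 0 and
      \<rho> with their preimages at time \<open>n\<close>, and in either case each refined block is
      wholly inside or wholly outside the tested set.\<close>
    have close: "\<bar>measure \<sigma> (A' \<times> B') - (\<Sum>a\<in>?L. \<Sum>b\<in>?L. (p a b * (v a * w b)) * (q a * q b))\<bar>
        \<le> (3 * P * (2 + P) + 2 * P) * ?D"
      if "A' \<in> sets M" "B' \<in> sets M"
        and v: "\<And>a. 0 \<le> v a \<and> v a \<le> 1" "\<And>a. a \<in> ?L \<Longrightarrow> prob (A' \<inter> E2 a) = v a * prob (E2 a)"
        and w: "\<And>a. 0 \<le> w a \<and> w a \<le> 1" "\<And>a. a \<in> ?L \<Longrightarrow> prob (B' \<inter> E2 a) = w a * prob (E2 a)"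
      for A' B' v w
    proof -
      have eq: "(\<Sum>a\<in>?L. \<Sum>b\<in>?L. p a b * (prob (A' \<inter> E2 a) * prob (B' \<inter> E2 b)))
          = (\<Sum>a\<in>?L. \<Sum>b\<in>?L. (p a b * (v a * w b)) * (prob (E2 a) * prob (E2 b)))"
        by (intro sum.cong refl) (simp add: v(2) w(2) mult_ac)
      have "\<bar>p a b * (v a * w b)\<bar> \<le> P" if "a \<in> ?L" "b \<in> ?L" for a b
      proof -
        have "p a b * (v a * w b) \<le> p a b"
          using p0[of a b] v(1)[of a] w(1)[of b] by (intro mult_left_le mult_le_one) auto
        moreover have "0 \<le> p a b * (v a * w b)" using p0[of a b] v(1)[of a] w(1)[of b] by simp
        ultimately show ?thesis using pP[OF that] by linarith
      qed
      from product_weights_error[of ?L "\<lambda>a b. p a b * (v a * w b)" P "\<lambda>a. prob (E2 a)" q, OF this _ m1 q0 q1]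
      have "\<bar>(\<Sum>a\<in>?L. \<Sum>b\<in>?L. (p a b * (v a * w b)) * (prob (E2 a) * prob (E2 b)))
          - (\<Sum>a\<in>?L. \<Sum>b\<in>?L. (p a b * (v a * w b)) * (q a * q b))\<bar> \<le> 2 * P * ?D"
        unfolding D by simp
      with \<sigma>_eq[OF that(1,2)] show ?thesis unfolding eq by (simp add: algebra_simps)
    qed
    show "\<exists>\<sigma>\<in>C2 M. \<forall>A\<in>\<A>. \<forall>B\<in>\<A>.
        \<bar>measure \<sigma> (A \<times> B) - measure \<eta> (A \<times> B)\<bar> \<le> (3 * P * (2 + P) + 2 * P) * ?D
      \<and> \<bar>measure ((lens M T ^^ n) \<sigma>) (A \<times> B) - measure \<rho> (A \<times> B)\<bar> \<le> (3 * P * (2 + P) + 2 * P) * ?D"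
    proof (intro bexI[OF _ \<sigma>] ballI conjI)
      fix A B assume A: "A \<in> \<A>" and B: "B \<in> \<A>"
      have mA: "A \<in> sets M" "B \<in> sets M" using A B \<A> by auto
      have fst_eq: "prob (X \<inter> E2 a) = u X (fst a) * prob (E2 a)" if "X \<in> \<A>" "a \<in> ?L" for X a
      proof -
        have "X \<inter> E2 a = (if E (fst a) \<subseteq> X then E2 a else {})"
          using ref[OF that(1), of "fst a"] that(2) by (auto simp: E2_def)
        then show ?thesis by (simp add: u_def)
      qed
      have snd_eq: "prob (((T ^^ n) -` X \<inter> space M) \<inter> E2 a) = u X (snd a) * prob (E2 a)" if "X \<in> \<A>" "a \<in> ?L" for X a
      proof -
        have "((T ^^ n) -` X \<inter> space M) \<inter> E2 a = (if E (snd a) \<subseteq> X then E2 a else {})"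
          using ref[OF that(1), of "snd a"] that(2) sub2[OF that(2)] by (auto simp: E2_def)
        then show ?thesis by (simp add: u_def)
      qed
      show "\<bar>measure \<sigma> (A \<times> B) - measure \<eta> (A \<times> B)\<bar> \<le> (3 * P * (2 + P) + 2 * P) * ?D"
        using close[OF mA, of "\<lambda>a. u A (fst a)" "\<lambda>b. u B (fst b)"] u fst_eq A B
        by (simp add: \<eta>_sum[OF A B])
      show "\<bar>measure ((lens M T ^^ n) \<sigma>) (A \<times> B) - measure \<rho> (A \<times> B)\<bar> \<le> (3 * P * (2 + P) + 2 * P) * ?D"
        using close[of "(T ^^ n) -` A \<inter> space M" "(T ^^ n) -` B \<inter> space M" "\<lambda>a. u A (snd a)" "\<lambda>b. u B (snd b)"]
          u snd_eq A B mA measurable_sets[OF funpow_measurable]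
        by (simp add: \<rho>_sum[OF A B] measure_lens_funpow[OF T_measurable \<sigma> mA])
    qed
  qed
qed

text \<open>Each coordinate gets its own approximating self-coupling, but the time is found from the
  mixing defect of one common partition, so the same \<open>n\<close> works for both. The starting
  couplings approximate a point of \<open>V\<close> and their images a point of
  \<open>U\<close>.\<close>

lemma weakly_mixing_imp_top_weakly_mixing:
  assumes wm: "weakly_mixing M T"
  shows "top_weakly_mixing (C2_topology M) (lens M T)"
  unfolding top_weakly_mixing_def top_transitive_def
proof (intro allI impI, elim conjE)
  fix U V :: "(('a \<times> 'a) measure \<times> ('a \<times> 'a) measure) set"
  let ?Z = "prod_topology (C2_topology M) (C2_topology M)" and ?R = "\<lambda>(x, y). (lens M T x, lens M T y)"
  assume U: "openin ?Z U" "U \<noteq> {}" and V: "openin ?Z V" "V \<noteq> {}"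
  obtain \<rho>1 \<rho>2 where "(\<rho>1, \<rho>2) \<in> U" using U(2) by auto
  with U(1) obtain U1 U2 where U1: "openin (C2_topology M) U1" "\<rho>1 \<in> U1"
    and U2: "openin (C2_topology M) U2" "\<rho>2 \<in> U2" and UU: "U1 \<times> U2 \<subseteq> U"
    unfolding openin_prod_topology_alt by blast
  obtain \<eta>1 \<eta>2 where "(\<eta>1, \<eta>2) \<in> V" using V(2) by auto
  with V(1) obtain V1 V2 where V1: "openin (C2_topology M) V1" "\<eta>1 \<in> V1"
    and V2: "openin (C2_topology M) V2" "\<eta>2 \<in> V2" and VV: "V1 \<times> V2 \<subseteq> V"
    unfolding openin_prod_topology_alt by blast
  have C2: "\<rho>1 \<in> C2 M" "\<rho>2 \<in> C2 M" "\<eta>1 \<in> C2 M" "\<eta>2 \<in> C2 M"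
    using U1 U2 V1 V2 by (metis openin_subset subsetD topspace_C2_topology)+
  obtain \<A>1 e1 where 1: "finite \<A>1" "\<A>1 \<subseteq> sets M" "0 < e1" and N1:
    "\<And>\<sigma>. \<sigma> \<in> C2 M \<Longrightarrow> (\<And>A B. A \<in> \<A>1 \<Longrightarrow> B \<in> \<A>1 \<Longrightarrow> \<bar>measure \<sigma> (A \<times> B) - measure \<rho>1 (A \<times> B)\<bar> < e1) \<Longrightarrow> \<sigma> \<in> U1"
    using openin_C2_neighbourhood[OF U1] by blast
  obtain \<A>2 e2 where 2: "finite \<A>2" "\<A>2 \<subseteq> sets M" "0 < e2" and N2:
    "\<And>\<sigma>. \<sigma> \<in> C2 M \<Longrightarrow> (\<And>A B. A \<in> \<A>2 \<Longrightarrow> B \<in> \<A>2 \<Longrightarrow> \<bar>measure \<sigma> (A \<times> B) - measure \<rho>2 (A \<times> B)\<bar> < e2) \<Longrightarrow> \<sigma> \<in> U2"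
    using openin_C2_neighbourhood[OF U2] by blast
  obtain \<A>3 e3 where 3: "finite \<A>3" "\<A>3 \<subseteq> sets M" "0 < e3" and N3:
    "\<And>\<sigma>. \<sigma> \<in> C2 M \<Longrightarrow> (\<And>A B. A \<in> \<A>3 \<Longrightarrow> B \<in> \<A>3 \<Longrightarrow> \<bar>measure \<sigma> (A \<times> B) - measure \<eta>1 (A \<times> B)\<bar> < e3) \<Longrightarrow> \<sigma> \<in> V1"
    using openin_C2_neighbourhood[OF V1] by blast
  obtain \<A>4 e4 where 4: "finite \<A>4" "\<A>4 \<subseteq> sets M" "0 < e4" and N4:
    "\<And>\<sigma>. \<sigma> \<in> C2 M \<Longrightarrow> (\<And>A B. A \<in> \<A>4 \<Longrightarrow> B \<in> \<A>4 \<Longrightarrow> \<bar>measure \<sigma> (A \<times> B) - measure \<eta>2 (A \<times> B)\<bar> < e4) \<Longrightarrow> \<sigma> \<in> V2"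
    using openin_C2_neighbourhood[OF V2] by blast
  define \<A> where "\<A> = \<A>1 \<union> \<A>2 \<union> \<A>3 \<union> \<A>4"
  define e where "e = min (min e1 e2) (min e3 e4)"
  have e: "0 < e" "e \<le> e1" "e \<le> e2" "e \<le> e3" "e \<le> e4" using 1 2 3 4 by (auto simp: e_def)
  have \<A>: "finite \<A>" "\<A> \<subseteq> sets M" using 1 2 3 4 by (auto simp: \<A>_def)
  obtain I :: "'a set set set" and E where E: "measurable_partition M I E"
    and ref: "\<And>A i. A \<in> \<A> \<Longrightarrow> i \<in> I \<Longrightarrow> E i \<subseteq> A \<or> A \<inter> E i = {}"
    using exists_partition_refining[OF \<A>] by blast
  obtain C where C: "0 \<le> C" and approx1: "\<And>n. \<exists>\<sigma>\<in>C2 M. \<forall>A\<in>\<A>. \<forall>B\<in>\<A>.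
      \<bar>measure \<sigma> (A \<times> B) - measure \<eta>1 (A \<times> B)\<bar> \<le> C * mixing_defect I E n
    \<and> \<bar>measure ((lens M T ^^ n) \<sigma>) (A \<times> B) - measure \<rho>1 (A \<times> B)\<bar> \<le> C * mixing_defect I E n"
    using lens_joint_approximation[OF E ref \<A>(2) C2(3) C2(1)] by blast
  obtain C' where C': "0 \<le> C'" and approx2: "\<And>n. \<exists>\<sigma>\<in>C2 M. \<forall>A\<in>\<A>. \<forall>B\<in>\<A>.
      \<bar>measure \<sigma> (A \<times> B) - measure \<eta>2 (A \<times> B)\<bar> \<le> C' * mixing_defect I E n
    \<and> \<bar>measure ((lens M T ^^ n) \<sigma>) (A \<times> B) - measure \<rho>2 (A \<times> B)\<bar> \<le> C' * mixing_defect I E n"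
    using lens_joint_approximation[OF E ref \<A>(2) C2(4) C2(2)] by blast
  \<comment> \<open>Dividing by \<open>C + C' + 1\<close> brings both errors below \<open>e\<close>;
    the summand 1 keeps the divisor positive.\<close>
  obtain n where n: "mixing_defect I E n < e / (C + C' + 1)"
    using weakly_mixing_small_defect[OF wm E, of "e / (C + C' + 1)"] e(1) C C' by auto
  have small: "K * mixing_defect I E n < e" if "0 \<le> K" "K \<le> C + C'" for K
  proof -
    have "K * mixing_defect I E n \<le> (C + C' + 1) * mixing_defect I E n"
      using that mixing_defect_nonneg[of I E n] by (intro mult_right_mono) auto
    also have "\<dots> < e" using n C C' by (simp add: field_simps)
    finally show ?thesis .
  qed
  have small1: "C * mixing_defect I E n < e" and small2: "C' * mixing_defect I E n < e"
    using small C C' by auto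
  obtain \<sigma>1 where \<sigma>1: "\<sigma>1 \<in> C2 M" and \<sigma>1_close: "\<And>A B. A \<in> \<A> \<Longrightarrow> B \<in> \<A> \<Longrightarrow>
      \<bar>measure \<sigma>1 (A \<times> B) - measure \<eta>1 (A \<times> B)\<bar> < e
    \<and> \<bar>measure ((lens M T ^^ n) \<sigma>1) (A \<times> B) - measure \<rho>1 (A \<times> B)\<bar> < e"
    using approx1[of n] small1 by (meson le_less_trans)
  obtain \<sigma>2 where \<sigma>2: "\<sigma>2 \<in> C2 M" and \<sigma>2_close: "\<And>A B. A \<in> \<A> \<Longrightarrow> B \<in> \<A> \<Longrightarrow>
      \<bar>measure \<sigma>2 (A \<times> B) - measure \<eta>2 (A \<times> B)\<bar> < e
    \<and> \<bar>measure ((lens M T ^^ n) \<sigma>2) (A \<times> B) - measure \<rho>2 (A \<times> B)\<bar> < e"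
    using approx2[of n] small2 by (meson le_less_trans)
  note lens_C2 = lens_funpow_in_C2[OF T_measurable distr_T]
  have "(lens M T ^^ n) \<sigma>1 \<in> U1"
    by (rule N1[OF lens_C2[OF \<sigma>1]]) (use \<sigma>1_close e(2) in \<open>force simp: \<A>_def\<close>)
  moreover have "(lens M T ^^ n) \<sigma>2 \<in> U2"
    by (rule N2[OF lens_C2[OF \<sigma>2]]) (use \<sigma>2_close e(3) in \<open>force simp: \<A>_def\<close>)
  moreover have "\<sigma>1 \<in> V1"
    by (rule N3[OF \<sigma>1]) (use \<sigma>1_close e(4) in \<open>force simp: \<A>_def\<close>)
  moreover have "\<sigma>2 \<in> V2"
    by (rule N4[OF \<sigma>2]) (use \<sigma>2_close e(5) in \<open>force simp: \<A>_def\<close>)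
  moreover have "(?R ^^ n) (\<sigma>1, \<sigma>2) = ((lens M T ^^ n) \<sigma>1, (lens M T ^^ n) \<sigma>2)"
    by (induction n) auto
  ultimately have "(\<sigma>1, \<sigma>2) \<in> (?R ^^ n) -` U \<inter> V" using UU VV by auto
  then show "\<exists>n. (?R ^^ n) -` U \<inter> V \<noteq> {}" by blast
qed

end

text \<open>Transitivity of the product map is tested on the squares \<open>U \<times> U\<close> and
  \<open>V \<times> V\<close>; either coordinate of a returning pair gives the required
  point.\<close>

lemma top_weakly_mixing_imp_transitive:
  assumes "top_weakly_mixing Z R"
  shows "top_transitive Z R"
  unfolding top_transitive_def
proof (intro allI impI, elim conjE)
  fix U V assume "openin Z U" "U \<noteq> {}" "openin Z V" "V \<noteq> {}"
  then have "openin (prod_topology Z Z) (U \<times> U)" "U \<times> U \<noteq> {}"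
    "openin (prod_topology Z Z) (V \<times> V)" "V \<times> V \<noteq> {}"
    by (auto simp: openin_prod_Times_iff)
  then obtain n where "((\<lambda>(x, y). (R x, R y)) ^^ n) -` (U \<times> U) \<inter> (V \<times> V) \<noteq> {}"
    using assms unfolding top_weakly_mixing_def top_transitive_def by blast
  moreover have "((\<lambda>(x, y). (R x, R y)) ^^ n) = (\<lambda>(x, y). ((R ^^ n) x, (R ^^ n) y))"
    by (induction n) auto
  ultimately show "\<exists>n. (R ^^ n) -` U \<inter> V \<noteq> {}" by auto
qed

theorem mainTheorem7:
  fixes M :: "'a::polish_space measure" and T :: "'a \<Rightarrow> 'a"
  assumes "standard_prob_space M"
    and "T \<in> Aut M"
    and "ergodic M T"
  shows "(weakly_mixing M T \<longleftrightarrow> top_transitive (C2_topology M) (lens M T))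
    \<and> (top_transitive (C2_topology M) (lens M T) \<longleftrightarrow> top_weakly_mixing (C2_topology M) (lens M T))"
proof -
  interpret prob_space M using assms(1) by (simp add: standard_prob_space_def)
  have T: "T \<in> M \<rightarrow>\<^sub>M M" and inv: "\<And>A. A \<in> sets M \<Longrightarrow> measure M (T -` A \<inter> space M) = measure M A"
    using assms(2) by (auto simp: Aut_def)
  have "distr M M T = M"
    by (rule measure_eqI) (simp_all add: T inv emeasure_distr emeasure_eq_measure)
  with T interpret measure_preserving_system M T by unfold_locales
  \<comment> \<open>The implications form a cycle: transitivity, ergodicity of the square, weak
    mixing, topological weak mixing, transitivity.\<close>
  show ?thesis
    using transitive_lens_imp_ergodic_product[OF assms(3)] ergodic_product_imp_weakly_mixing[OF assms(3)]
      weakly_mixing_imp_top_weakly_mixing top_weakly_mixing_imp_transitive by blast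
qed

end
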